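(* Let $m\ge2$ and let $f_1,\dots,f_m:\mathbb{R}^n\to\mathbb{R}$ be differentiable with $L$-Lipschitz gradients and $\mathbb{E}[f_i(x_k)]\ge F_{\inf}>-\infty$ for all $i\in[m]$ and all iterates $x_k$. Assume that at every iterate $x_k$ and for all $i\in[m]$ $$\nabla f_i(x_k)=\mathbb{E}[\nabla f_i(x_k;\xi)],\qquad \mathbb{E}\|\nabla f_i(x_k;\xi)\|_2^2\le C_f^2,\qquad \mathbb{E}\|\nabla f_i(x_k;\xi)-\nabla f_i(x_k)\|_2^2\le\delta^2,$$ with $C_f>0$, $\delta\ge0$. Let $$M_*^2=(2+\ln m)m^2C_f^4+\left(\tfrac12+\ln m\right)m^2C_f^2\delta^2,\qquad M_1=\left(\frac{2\bar D_{\omega_z,Z}^2S}{S-\lceil rS\rceil+1}+2\right)\max\{\theta,\theta^{-1}\}M_*.$$ Run the MSMD method (defined in the context) with fixed inner step size $\gamma_s=\frac{\theta}{M_*\sqrt S}$, $\theta>0$, fixed outer step size $\alpha_k=\alpha$ with $0<\alpha\le\frac1{4L}$, and $P=\lceil rS\rceil$, $r\in(0,1)$. (a) If $S=(K+1)^2$, then $$\frac1K\sum_{k=0}^{K-1}\mathbb{E}\|d_k\|_2^2\le O\left(4C_fM_1^{1/2}\frac{1}{\sqrt K}\right).$$ (b) If $S=(k+1)^2$ at outer iteration $k$ and the total number of iterations satisfies $K\ge4$, then $$\frac1K\sum_{k=0}^{K-1}\mathbb{E}\|d_k\|_2^2\le O\left(\max\left\{8C_fM_1^{1/2},\,4L\alpha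 M_1\right\}\frac{1}{\sqrt K}\right).$$
   Context: $\nabla f_i(x;\xi)$ is a stochastic gradient of $f_i$, $\xi$ a random vector with a fixed distribution supported on $\Xi$. In the assumptions on stochastic gradients, $\mathbb{E}$ is over $\xi$ with $x_k$ held fixed; elsewhere it is total expectation. $[m]=\{1,\dots,m\}$, $\Delta^m=\{\lambda\in\mathbb{R}^m:\lambda\ge0,\sum_i\lambda_i=1\}$, $C=\{d\in\mathbb{R}^n:\|d\|_2\le C_f\}$, $Z=C\times\Delta^m$. "$a_K\le O(b_K)$" means: there is a constant $c>0$ not depending on $K$ (it may depend on the fixed problem and method constants) with $a_K\le c\,b_K$ for all admissible $K\ge1$. In (b), where $S$ depends on $k$, $M_1$ is read as the maximum of the displayed expression over $S=(k+1)^2$, $0\le k\le K-1$. Steepest common descent direction at $x_k$: $d_k=\arg\min_{d\in\mathbb{R}^n}\max_{i\in[m]}\nabla f_i(x_k)^Td+\frac12\|d\|_2^2$. Subproblem gradient at $x_k$: for $z=(d,\lambda)\in Z$, $$\nabla\phi_z(z;\xi)=\Big(\sum_{i=1}^m\lambda_i\nabla f_i(x_k;\xi)+d,\ -\big(\langle\nabla f_i(x_k;\xi),d\rangle\big)_{i=1}^m\Big)\in\mathbb{R}^{n}\times\mathbb{R}^m.$$ Bregman data: $\omega_z(d,\lambda)=\frac{1}{2C_f^2}\|d\|_2^2+\frac{1}{2\ln m}\sum_{i=1}^m\lambda_i\ln\lambda_i$ on $Z$ (with $0\ln0=0$), $V(u,v)=\omega_z(v)-\omega_z(u)-\nabla\omega_z(u)^T(v-u)$,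 prox-mapping $P_z(\zeta)=\arg\min_{u\in Z}\{\zeta^T(u-z)+V(z,u)\}$, and $\bar D_{\omega_z,Z}=\sup_{u,v\in Z}\sqrt{2V(u,v)}$. The paper takes $V(u,v)\le\frac12\bar D_{\omega_z,Z}^2<+\infty$ for all $u,v\in Z$. MSMD method (number of inner steps $S$, inner step sizes $\gamma_s$, outer step sizes $\alpha_k$, ratio $r\in(0,1)$, $P=\lceil rS\rceil$): given $x_0\in\mathbb{R}^n$, at outer iteration $k=0,\dots,K-1$ set $d_{k,0}=0$, $\lambda_{k,0}=(1/m,\dots,1/m)$; for $s=0,\dots,S-1$ draw an i.i.d. sample $\xi_s$ (independent of $x_k$ and of all earlier samples) and set $z_{k,s+1}=P_{z_{k,s}}(\gamma_s\nabla\phi_z(z_{k,s};\xi_s))$; then set $z_{k,P}^S=(d_{k,P}^S,\lambda_{k,P}^S)=\big(\sum_{s=P}^S\gamma_s z_{k,s}\big)/\sum_{s=P}^S\gamma_s$ and $x_{k+1}=x_k+\alpha_k d_{k,P}^S$.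
   Formalization: For the entropy part of ω_z the supremum D̄ is infinite (let a weight of u tend to 0), contrary to the assumed finiteness; the formal theorem drops that assumption and proves the bounds with any real D, 0 ≤ D ≤ D̄, in place of D̄ in M_1. *)

theory Defs
  imports "HOL-Probability.Probability"
begin

definition grad :: "('a::real_inner \<Rightarrow> real) \<Rightarrow> 'a \<Rightarrow> 'a" where
  "grad F x = (THE g. GDERIV F x :> g)"


subsection \<open>The problem and its stochastic oracle\<close>

text \<open>Objectives are indexed by a finite type \<open>'m\<close>, so that \<open>m = CARD('m)\<close>.\<close>

definition common_descent ::
  "('m::finite \<Rightarrow> real^'n \<Rightarrow> real) \<Rightarrow> real^'n \<Rightarrow> real^'n" where
  "common_descent f x =
     arg_min_on (\<lambda>d. (MAX i\<in>UNIV. grad (f i) x \<bullet> d) + 1/2 * (norm d)\<^sup>2) UNIV"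

text \<open>Conditions on the stochastic gradients at a point \<open>x\<close>, which is held fixed; \<open>Q\<close> is the law
  of the sample. The second moments are Lebesgue integrals in the extended nonnegative reals, so
  that the bounds include their finiteness.\<close>

definition oracle_at ::
  "'x measure \<Rightarrow> ('m::finite \<Rightarrow> real^'n \<Rightarrow> real) \<Rightarrow> ('m \<Rightarrow> real^'n \<Rightarrow> 'x \<Rightarrow> real^'n)
     \<Rightarrow> real \<Rightarrow> real \<Rightarrow> real^'n \<Rightarrow> bool" where
  "oracle_at Q f G C\<^sub>f \<delta> x \<longleftrightarrow> (\<forall>i.
     has_bochner_integral Q (G i x) (grad (f i) x) \<and>
     (\<integral>\<^sup>+ y. ennreal ((norm (G i x y))\<^sup>2) \<partial>Q) \<le> ennreal (C\<^sub>f\<^sup>2) \<and>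
     (\<integral>\<^sup>+ y. ennreal ((norm (G i x y - grad (f i) x))\<^sup>2) \<partial>Q) \<le> ennreal (\<delta>\<^sup>2))"


subsection \<open>Bregman data\<close>

definition prob_simplex :: "(real^'m) set" where
  "prob_simplex = {l. (\<forall>i. 0 \<le> l $ i) \<and> (\<Sum>i\<in>UNIV. l $ i) = 1}"

definition Z_set :: "real \<Rightarrow> ((real^'n) \<times> (real^'m)) set" where
  "Z_set C\<^sub>f = cball 0 C\<^sub>f \<times> prob_simplex"

definition omega_z :: "real \<Rightarrow> (real^'n) \<times> (real^'m) \<Rightarrow> real" where
  "omega_z C\<^sub>f = (\<lambda>(d, l). 1 / (2 * C\<^sub>f\<^sup>2) * (norm d)\<^sup>2
     + 1 / (2 * ln (real CARD('m))) * (\<Sum>i\<in>UNIV. l $ i * ln (l $ i)))"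

definition bregman :: "('a::real_inner \<Rightarrow> real) \<Rightarrow> 'a \<Rightarrow> 'a \<Rightarrow> real" where
  "bregman w u v = w v - w u - grad w u \<bullet> (v - u)"

text \<open>The first argument of the divergence ranges over the points where the gradient exists; for
  \<^term>\<open>omega_z\<close> these are the points with positive weights. For the entropy this
  supremum is infinite as soon as there are two weights (let a weight of \<open>u\<close> tend to 0),
  while the rate constants need a finite value; they are therefore formed with a real
  \<open>D\<close> bounded by the supremum, which covers \<open>D\<close> equal to the supremum
  whenever that is finite.\<close>

definition bregman_diam :: "('a::real_inner \<Rightarrow> real) \<Rightarrow> 'a set \<Rightarrow> ereal" where
  "bregman_diam w Z =
     (SUP u\<in>{u\<in>Z. w differentiable (at u)}. SUP v\<in>Z. ereal (sqrt (2 * bregman w u v)))"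

definition prox_map ::
  "real \<Rightarrow> (real^'n) \<times> (real^'m) \<Rightarrow> (real^'n) \<times> (real^'m) \<Rightarrow> (real^'n) \<times> (real^'m)" where
  "prox_map C\<^sub>f z \<zeta> =
     arg_min_on (\<lambda>u. \<zeta> \<bullet> (u - z) + bregman (omega_z C\<^sub>f) z u) (Z_set C\<^sub>f)"


subsection \<open>The MSMD method\<close>

definition grad_phi ::
  "('m::finite \<Rightarrow> real^'n) \<Rightarrow> (real^'n) \<times> (real^'m) \<Rightarrow> (real^'n) \<times> (real^'m)" where
  "grad_phi g = (\<lambda>(d, l). ((\<Sum>i\<in>UNIV. l $ i *\<^sub>R g i) + d, (\<chi> i. - (g i \<bullet> d))))"

text \<open>In the inner loop, \<open>g s i\<close> is the stochastic gradient of the \<open>i\<close>-th objective at the current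
  outer iterate and the \<open>s\<close>-th sample.\<close>

primrec msmd_inner ::
  "real \<Rightarrow> (nat \<Rightarrow> real) \<Rightarrow> (nat \<Rightarrow> 'm::finite \<Rightarrow> real^'n) \<Rightarrow> nat \<Rightarrow> (real^'n) \<times> (real^'m)" where
  "msmd_inner C\<^sub>f \<gamma> g 0 = (0, (\<chi> i. 1 / real CARD('m)))"
| "msmd_inner C\<^sub>f \<gamma> g (Suc s) =
     prox_map C\<^sub>f (msmd_inner C\<^sub>f \<gamma> g s) (\<gamma> s *\<^sub>R grad_phi (g s) (msmd_inner C\<^sub>f \<gamma> g s))"

definition weighted_avg ::
  "(nat \<Rightarrow> real) \<Rightarrow> (nat \<Rightarrow> 'a::real_vector) \<Rightarrow> nat \<Rightarrow> nat \<Rightarrow> 'a" where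
  "weighted_avg \<gamma> z P S = (1 / (\<Sum>s=P..S. \<gamma> s)) *\<^sub>R (\<Sum>s=P..S. \<gamma> s *\<^sub>R z s)"

text \<open>The \<open>k\<close>-th outer iterate for the samples \<open>y k s\<close>. The number \<open>S k\<close> of inner steps and the
  step sizes \<open>\<gamma> k s\<close> and \<open>\<alpha> k\<close> may depend on the outer iteration \<open>k\<close>.\<close>

primrec msmd ::
  "('m::finite \<Rightarrow> real^'n \<Rightarrow> 'x \<Rightarrow> real^'n) \<Rightarrow> real \<Rightarrow> real \<Rightarrow> (nat \<Rightarrow> nat) \<Rightarrow> (nat \<Rightarrow> nat \<Rightarrow> real)
     \<Rightarrow> (nat \<Rightarrow> real) \<Rightarrow> real^'n \<Rightarrow> (nat \<Rightarrow> nat \<Rightarrow> 'x) \<Rightarrow> nat \<Rightarrow> real^'n" where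
  "msmd G C\<^sub>f r S \<gamma> \<alpha> x\<^sub>0 y 0 = x\<^sub>0"
| "msmd G C\<^sub>f r S \<gamma> \<alpha> x\<^sub>0 y (Suc k) =
     (let x = msmd G C\<^sub>f r S \<gamma> \<alpha> x\<^sub>0 y k;
          z = msmd_inner C\<^sub>f (\<gamma> k) (\<lambda>s i. G i x (y k s))
      in x + \<alpha> k *\<^sub>R fst (weighted_avg (\<gamma> k) z (nat \<lceil>r * real (S k)\<rceil>) (S k)))"


subsection \<open>Constants\<close>

definition M_star :: "nat \<Rightarrow> real \<Rightarrow> real \<Rightarrow> real" where
  "M_star m C\<^sub>f \<delta> = sqrt ((2 + ln (real m)) * (real m)\<^sup>2 * C\<^sub>f ^ 4
     + (1/2 + ln (real m)) * (real m)\<^sup>2 * C\<^sub>f\<^sup>2 * \<delta>\<^sup>2)"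

definition M_one :: "nat \<Rightarrow> real \<Rightarrow> real \<Rightarrow> real \<Rightarrow> real \<Rightarrow> real \<Rightarrow> nat \<Rightarrow> real" where
  "M_one m C\<^sub>f \<delta> r \<theta> D S =
     (2 * D\<^sup>2 * real S / (real S - real_of_int \<lceil>r * real S\<rceil> + 1) + 2)
       * max \<theta> (1 / \<theta>) * M_star m C\<^sub>f \<delta>"


subsection \<open>The quantities of the rate statement\<close>

text \<open>The method with the fixed step sizes \<open>\<theta> / (M_* sqrt S)\<close> and \<open>\<alpha>\<close>; \<open>\<xi> k s\<close> is the
  random sample drawn at inner step \<open>s\<close> of outer iteration \<open>k\<close>.\<close>

definition msmd_run ::
  "('m::finite \<Rightarrow> real^'n \<Rightarrow> 'x \<Rightarrow> real^'n) \<Rightarrow> real \<Rightarrow> real \<Rightarrow> real \<Rightarrow> real \<Rightarrow> real \<Rightarrow> real^'n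
     \<Rightarrow> (nat \<Rightarrow> nat \<Rightarrow> 'w \<Rightarrow> 'x) \<Rightarrow> (nat \<Rightarrow> nat) \<Rightarrow> nat \<Rightarrow> 'w \<Rightarrow> real^'n" where
  "msmd_run G C\<^sub>f \<delta> r \<theta> \<alpha> x\<^sub>0 \<xi> S k \<omega> =
     msmd G C\<^sub>f r S (\<lambda>j s. \<theta> / (M_star CARD('m) C\<^sub>f \<delta> * sqrt (real (S j)))) (\<lambda>j. \<alpha>) x\<^sub>0
       (\<lambda>j s. \<xi> j s \<omega>) k"

text \<open>The assumptions along a run \<open>x\<^sub>0, \<dots>, x\<^sub>K\<close>; gradients are only sampled at
  \<open>x\<^sub>0, \<dots>, x\<^sub>K\<^sub>-\<^sub>1\<close>.\<close>

definition assumptions_along ::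
  "'w measure \<Rightarrow> 'x measure \<Rightarrow> ('m::finite \<Rightarrow> real^'n \<Rightarrow> real)
     \<Rightarrow> ('m \<Rightarrow> real^'n \<Rightarrow> 'x \<Rightarrow> real^'n) \<Rightarrow> real \<Rightarrow> real \<Rightarrow> real
     \<Rightarrow> (nat \<Rightarrow> 'w \<Rightarrow> real^'n) \<Rightarrow> nat \<Rightarrow> bool" where
  "assumptions_along M Q f G C\<^sub>f \<delta> F_inf X K \<longleftrightarrow>
     (\<forall>k<K. AE \<omega> in M. oracle_at Q f G C\<^sub>f \<delta> (X k \<omega>)) \<and>
     (\<forall>k\<le>K. \<forall>i. F_inf \<le> (\<integral>\<omega>. f i (X k \<omega>) \<partial>M))"

definition mean_sq_direction ::
  "'w measure \<Rightarrow> ('m::finite \<Rightarrow> real^'n \<Rightarrow> real) \<Rightarrow> (nat \<Rightarrow> 'w \<Rightarrow> real^'n) \<Rightarrow> nat \<Rightarrow> real" where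
  "mean_sq_direction M f X K =
     1 / real K * (\<Sum>k<K. \<integral>\<omega>. (norm (common_descent f (X k \<omega>)))\<^sup>2 \<partial>M)"

end

theory Submission
  imports Defs
begin

text \<open>
  Inner loop: the Bregman divergence from \<open>z\<^sub>s\<close> to the saddle point \<open>(d\<^sub>k, \<lambda>\<^sub>k)\<close> of the subproblem is a
  Lyapunov function. The bilinear part of the subproblem operator is skew and its quadratic part is
  the identity in \<open>d\<close>, so one step decreases the expected divergence by
  \<open>\<gamma> E\<parallel>d\<^sub>s - d\<^sub>k\<parallel>\<^sup>2\<close> up to \<open>O(\<gamma>\<^sup>2)\<close>. The divergence starts below 1; summing over all steps and then
  dropping the nonnegative terms before \<open>P\<close> gives an averaged direction with expected squared
  error \<open>O(1 / sqrt S)\<close>.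

  Outer loop: at the saddle point \<open>grad f\<^sub>i \<bullet> d\<^sub>k \<le> - \<parallel>d\<^sub>k\<parallel>\<^sup>2\<close>, so smoothness of a single \<open>f\<^sub>i\<close> gives a
  decrease of \<open>\<alpha>/2 \<parallel>d\<^sub>k\<parallel>\<^sup>2\<close> up to an error \<open>O(S powr (-1/4))\<close>. Telescoping yields the rate, as \<open>M\<^sub>1\<close> is
  bounded below by a positive constant.
\<close>

subsection \<open>Smooth objectives and the common descent direction\<close>

text \<open>The weights may approach the boundary of the simplex, where the entropy divergence is
  unbounded, so a duality-gap analysis with a supremum over Z would lose control. A single
  comparison point avoids this: once x_k is given, the saddle point is deterministic, the sampling
  noise has mean zero against it, and only its divergence from the uniform start has to be finite.
  The stochastic gradients have bounded second moments but no pointwise bound. The entropy part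
  therefore needs an exponential inequality valid for every real argument. Expectations with x_k
  held fixed are obtained without conditional expectations: past and fresh randomness are functions
  of disjoint blocks of one independent family, and Fubini for the product law allows the past to be
  frozen. The exponent 1/4 arises because the descent inequality is linear in the direction error
  while the inner loop controls its square. With S = n^2 the loss per outer step is of order 1 /
  sqrt n, which explains the quadratic growth of S.\<close>

lemma arg_min_on_unique:
  fixes h :: "'a \<Rightarrow> real"
  assumes "x \<in> S" "\<And>y. y \<in> S \<Longrightarrow> y \<noteq> x \<Longrightarrow> h x < h y"
  shows "arg_min_on h S = x"
proof -
  have "is_arg_min h (\<lambda>y. y \<in> S) y \<longleftrightarrow> y = x" for y
    using assms unfolding is_arg_min_linorder by (metis leD linear order_less_le)
  then have "is_arg_min h (\<lambda>y. y \<in> S) = (\<lambda>y. y = x)"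
    by blast
  then show ?thesis
    unfolding arg_min_on_def arg_min_def by simp
qed

lemma grad_eqI: "GDERIV F x :> g \<Longrightarrow> grad F x = g"
  unfolding grad_def gderiv_def
proof (rule the_equality)
  fix g' assume "(F has_derivative (\<lambda>h. h \<bullet> g)) (at x)" "(F has_derivative (\<lambda>h. h \<bullet> g')) (at x)"
  then have "(\<lambda>h. h \<bullet> g) = (\<lambda>h. h \<bullet> g')"
    by (rule has_derivative_unique)
  then show "g' = g"
    by (metis inner_commute vector_eq_rdot)
qed

lemma GDERIV_grad:
  fixes F :: "'a::euclidean_space \<Rightarrow> real"
  assumes "F differentiable (at x)"
  shows "GDERIV F x :> grad F x"
proof -
  obtain F' where F': "(F has_derivative F') (at x)"
    using assms unfolding differentiable_def by blast
  then have "linear F'"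
    by (rule has_derivative_linear)
  \<comment> \<open>Riesz representation: a linear functional is a linear map into the reals, and
    its adjoint sends 1 to the representing vector.\<close>
  then have "F' = (\<lambda>h. h \<bullet> adjoint F' 1)"
    by (simp add: adjoint_works)
  with F' have "GDERIV F x :> adjoint F' 1"
    unfolding gderiv_def by simp
  then show ?thesis
    using grad_eqI by metis
qed

text \<open>The mean value theorem along the segment gives the constant L instead of the sharp L /
  2. The bound \<alpha> \<le> 1 / (4 L) leaves exactly enough room for it.\<close>

lemma lipschitz_grad_upper_bound:
  fixes F :: "'a::euclidean_space \<Rightarrow> real"
  assumes diff: "\<And>x. F differentiable (at x)" and lip: "L-lipschitz_on UNIV (grad F)"
  shows "F (x + v) \<le> F x + grad F x \<bullet> v + L * (norm v)\<^sup>2"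
proof -
  define \<phi> where "\<phi> t = F (x + t *\<^sub>R v)" for t
  have der: "(\<phi> has_real_derivative grad F (x + t *\<^sub>R v) \<bullet> v) (at t)" for t
  proof -
    have "(F has_derivative (\<lambda>h. h \<bullet> grad F (x + t *\<^sub>R v))) (at (x + t *\<^sub>R v))"
      using GDERIV_grad[OF diff] unfolding gderiv_def .
    moreover have "((\<lambda>t. x + t *\<^sub>R v) has_derivative (\<lambda>h. h *\<^sub>R v)) (at t)"
      by (auto intro!: derivative_eq_intros)
    ultimately have "(\<phi> has_derivative (\<lambda>h. (h *\<^sub>R v) \<bullet> grad F (x + t *\<^sub>R v))) (at t)"
      unfolding \<phi>_def by (rule has_derivative_compose[rotated])
    then show ?thesis
      by (simp add: has_field_derivative_def inner_commute mult_commute_abs)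
  qed
  obtain t where t: "0 < t" "t < 1" "\<phi> 1 - \<phi> 0 = (1 - 0) * (grad F (x + t *\<^sub>R v) \<bullet> v)"
    using MVT2[of 0 1 \<phi> "\<lambda>t. grad F (x + t *\<^sub>R v) \<bullet> v"] der by auto
  have "(grad F (x + t *\<^sub>R v) - grad F x) \<bullet> v \<le> norm (grad F (x + t *\<^sub>R v) - grad F x) * norm v"
    by (rule norm_cauchy_schwarz)
  also have "\<dots> \<le> (L * norm (t *\<^sub>R v)) * norm v"
    using lipschitz_onD[OF lip, of "x + t *\<^sub>R v" x]
    by (intro mult_right_mono) (auto simp: dist_norm)
  also have "\<dots> = t * (L * (norm v)\<^sup>2)"
    using t by (simp add: power2_eq_square)
  also have "\<dots> \<le> 1 * (L * (norm v)\<^sup>2)"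
    using t lipschitz_on_nonneg[OF lip] by (intro mult_right_mono) auto
  finally show ?thesis
    using t by (simp add: \<phi>_def inner_diff_left)
qed

lemma continuous_on_if_differentiable:
  fixes F :: "'a::euclidean_space \<Rightarrow> real"
  assumes "\<And>x. F differentiable (at x)"
  shows "continuous_on A F"
  using assms by (meson continuous_at_imp_continuous_on differentiable_imp_continuous_within)

lemma prob_simplexD:
  assumes "l \<in> prob_simplex"
  shows "0 \<le> l $ i" "(\<Sum>i\<in>UNIV. l $ i) = 1" "l $ i \<le> 1"
proof -
  have nn: "0 \<le> l $ i" for i
    using assms by (auto simp: prob_simplex_def)
  then show "0 \<le> l $ i" .
  show s: "(\<Sum>i\<in>UNIV. l $ i) = 1"
    using assms by (auto simp: prob_simplex_def)
  show "l $ i \<le> 1"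
    using member_le_sum[of i UNIV "\<lambda>i. l $ i"] nn s by auto
qed

lemma compact_convex_prob_simplex:
  "compact (prob_simplex :: (real^'m) set)" "convex (prob_simplex :: (real^'m) set)"
proof -
  have eq: "(prob_simplex :: (real^'m) set) = (\<Inter>i. {l::real^'m. 0 \<le> l $ i}) \<inter> {l. (\<Sum>i\<in>UNIV. l $ i) = 1}"
    by (auto simp: prob_simplex_def)
  have "closed {l::real^'m. 0 \<le> l $ i}" for i
    by (intro closed_Collect_le continuous_intros)
  moreover have "closed {l::real^'m. (\<Sum>i\<in>UNIV. l $ i) = 1}"
    by (intro closed_Collect_eq continuous_intros)
  ultimately have "closed (prob_simplex :: (real^'m) set)"
    unfolding eq by (intro closed_Int closed_INT) auto
  moreover have "bounded (prob_simplex :: (real^'m) set)"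
  proof (rule boundedI)
    fix l :: "real^'m" assume l: "l \<in> prob_simplex"
    have "norm l \<le> (\<Sum>i\<in>UNIV. \<bar>l $ i\<bar>)"
      by (rule norm_le_l1_cart)
    also have "\<dots> = 1"
      using prob_simplexD[OF l] by simp
    finally show "norm l \<le> 1" .
  qed
  ultimately show "compact (prob_simplex :: (real^'m) set)"
    by (simp add: compact_eq_bounded_closed)
  show "convex (prob_simplex :: (real^'m) set)"
    by (rule convexI) (auto simp: prob_simplex_def sum.distrib simp flip: sum_distrib_left)
qed

lemma axis_in_prob_simplex: "axis i 1 \<in> prob_simplex"
  by (auto simp: prob_simplex_def axis_def)

lemma prob_simplex_average_le:
  assumes "l \<in> prob_simplex" "\<And>i. h i \<le> (c::real)"
  shows "(\<Sum>i\<in>UNIV. l $ i * h i) \<le> c"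
proof -
  have "(\<Sum>i\<in>UNIV. l $ i * h i) \<le> (\<Sum>i\<in>UNIV. l $ i * c)"
    using assms prob_simplexD(1)[OF assms(1)] by (intro sum_mono mult_left_mono) auto
  then show ?thesis
    using prob_simplexD(2)[OF assms(1)] by (simp flip: sum_distrib_right)
qed

text \<open>The minimal-norm point \<open>p\<close> of the convex hull of the gradients satisfies
  \<open>g\<^sub>i \<bullet> p \<ge> p \<bullet> p\<close>, so \<open>d = - p\<close> and its weights form a saddle point.\<close>

lemma common_descent_saddle:
  fixes f :: "'m::finite \<Rightarrow> real^'n \<Rightarrow> real"
  obtains l where "l \<in> prob_simplex"
    "common_descent f x = - (\<Sum>i\<in>UNIV. l $ i *\<^sub>R grad (f i) x)"
    "\<And>i. grad (f i) x \<bullet> common_descent f x \<le> - (norm (common_descent f x))\<^sup>2"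
proof -
  define g where "g i = grad (f i) x" for i
  define T where "T l = (\<Sum>i\<in>UNIV. l $ i *\<^sub>R g i)" for l :: "real^'m"
  have lin: "linear T"
    unfolding T_def
    by (rule linearI) (simp_all add: scaleR_left_distrib sum.distrib scaleR_sum_right)
  define H where "H = T ` prob_simplex"
  have H: "compact H" "convex H"
    unfolding H_def using compact_convex_prob_simplex lin
    by (auto intro!: compact_continuous_image convex_linear_image linear_continuous_on
        simp: linear_conv_bounded_linear)
  have gH: "g i \<in> H" for i
  proof -
    have "T (axis i 1) = g i"
      unfolding T_def by (simp add: axis_def if_distrib[of "\<lambda>c. c *\<^sub>R _"] cong: if_cong)
    then show ?thesis
      unfolding H_def using axis_in_prob_simplex by (metis imageI)
  qed
  obtain p where p: "p \<in> H" "\<forall>y\<in>H. dist 0 p \<le> dist 0 y"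
    using distance_attains_inf[OF compact_imp_closed[OF H(1)], of 0] gH by (metis empty_iff)
  have pg: "p \<bullet> p \<le> g i \<bullet> p" for i
    using any_closest_point_dot[OF H(2) compact_imp_closed[OF H(1)] p(1) gH p(2), of i]
    by (simp add: inner_diff_right inner_commute)
  obtain l where l: "l \<in> prob_simplex" "T l = p"
    using p(1) unfolding H_def by auto
  define h where "h d = (MAX i\<in>UNIV. g i \<bullet> d) + 1/2 * (norm d)\<^sup>2" for d
  \<comment> \<open>Weak duality: the maximum dominates the average with weights \<open>l\<close>,
    which is linear in d with slope p. Completing the square then leaves a lower bound that is
    uniquely minimal at -p.\<close>
  have lower: "1/2 * (norm (d + p))\<^sup>2 - 1/2 * (norm p)\<^sup>2 \<le> h d" for d
  proof -
    have "(\<Sum>i\<in>UNIV. l $ i * (g i \<bullet> d)) \<le> (MAX i\<in>UNIV. g i \<bullet> d)"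
      using l(1) by (intro prob_simplex_average_le) auto
    also have "(\<Sum>i\<in>UNIV. l $ i * (g i \<bullet> d)) = p \<bullet> d"
      unfolding l(2)[symmetric] T_def by (simp add: inner_sum_left)
    finally show ?thesis
      unfolding h_def by (simp add: power2_norm_eq_inner inner_add_left inner_add_right inner_commute field_simps)
  qed
  have at_min: "h (- p) \<le> - 1/2 * (norm p)\<^sup>2"
  proof -
    have "(MAX i\<in>UNIV. g i \<bullet> - p) \<le> - (p \<bullet> p)"
      using pg by (intro Max.boundedI) auto
    then show ?thesis
      unfolding h_def norm_minus_cancel power2_norm_eq_inner by linarith
  qed
  have "common_descent f x = - p"
    unfolding common_descent_def g_def[symmetric] h_def[symmetric]
  proof (rule arg_min_on_unique)
    fix y assume "y \<noteq> - p"
    then have "0 < (norm (y + p))\<^sup>2"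
      by (simp add: add_eq_0_iff2)
    then show "h (- p) < h y"
      using lower[of y] at_min by linarith
  qed simp
  with l pg show thesis
    by (intro that[of l]) (auto simp: T_def g_def power2_norm_eq_inner)
qed

subsection \<open>The prox-mapping\<close>

definition kl :: "real^'m \<Rightarrow> real^'m \<Rightarrow> real" where
  "kl p q = (\<Sum>i\<in>UNIV. p $ i * (ln (p $ i) - ln (q $ i)))"

text \<open>Gibbs' inequality: \<open>ln t \<le> t - 1\<close> at t = q_i / p_i bounds each term
  below by p_i - q_i, and these differences sum to zero. Strictness is what makes the prox point a
  unique minimiser.\<close>

lemma kl_pos_strict:
  assumes "p \<in> prob_simplex" "q \<in> prob_simplex" "\<And>i. 0 < q $ i" "p \<noteq> q"
  shows "0 < kl p q"
proof -
  have strict: "p $ i - q $ i < p $ i * (ln (p $ i) - ln (q $ i))" if "p $ i \<noteq> q $ i" for i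
  proof (cases "p $ i = 0")
    case True
    then show ?thesis using assms(3) by simp
  next
    case False
    then have pos: "0 < p $ i"
      using prob_simplexD(1)[OF assms(1), of i] by linarith
    have "ln (q $ i / p $ i) < q $ i / p $ i - 1"
      using ln_le_minus_one[of "q $ i / p $ i"] ln_eq_minus_one[of "q $ i / p $ i"] that pos assms(3)[of i]
      by fastforce
    then have "p $ i * (ln (q $ i) - ln (p $ i)) < p $ i * (q $ i / p $ i - 1)"
      using pos assms(3)[of i] by (simp add: ln_div)
    then show ?thesis
      using pos by (simp add: algebra_simps)
  qed
  obtain j where j: "p $ j \<noteq> q $ j"
    using assms(4) by (auto simp: vec_eq_iff)
  have "(\<Sum>i\<in>UNIV. p $ i - q $ i) < kl p q"
    unfolding kl_def
  proof (rule sum_strict_mono_ex1)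
    show "\<forall>i\<in>UNIV. p $ i - q $ i \<le> p $ i * (ln (p $ i) - ln (q $ i))"
      using strict by (metis diff_self mult_zero_right order_less_imp_le order_refl)
  qed (use j strict in auto)
  then show ?thesis
    using prob_simplexD(2)[OF assms(1)] prob_simplexD(2)[OF assms(2)] by (simp add: sum_subtractf)
qed

lemma kl_nonneg:
  assumes "p \<in> prob_simplex" "q \<in> prob_simplex" "\<And>i. 0 < q $ i"
  shows "0 \<le> kl p q"
  using kl_pos_strict[OF assms] by (cases "p = q") (auto simp: kl_def)

text \<open>Up to x = 1 the exponential lies below 1 + x + x^2, hence below x + exp (x^2); beyond 1,
  x \<le> x^2 suffices. The absence of a restriction on x is essential, because stochastic gradients
  are not bounded pointwise.\<close>

lemma exp_le_add_exp_square: "exp x \<le> x + exp (x\<^sup>2)" for x :: real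
proof -
  have quad: "exp x \<le> 1 + x + x\<^sup>2 \<Longrightarrow> ?thesis"
    using exp_ge_add_one_self[of "x\<^sup>2"] by linarith
  consider "x < 0" | "0 \<le> x" "x \<le> 1" | "1 < x" by linarith
  then show ?thesis
  proof cases
    case 1
    define y where "y = - x"
    have y: "0 < y" using 1 by (simp add: y_def)
    \<comment> \<open>Multiplication by exp y turns the desired upper bound on exp (-y) into a lower
      bound, where the quadratic Taylor bound for exp y applies.\<close>
    have "1 \<le> (1 - y + y\<^sup>2) * (1 + y + y\<^sup>2 / 2)"
    proof -
      have "(1 - y + y\<^sup>2) * (1 + y + y\<^sup>2 / 2) = 1 + y^2/2 + y^3/2 + y^4/2"
        by (simp add: field_simps power2_eq_square power3_eq_cube power4_eq_xxxx)
      then show ?thesis using y by simp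
    qed
    also have "\<dots> \<le> (1 - y + y\<^sup>2) * exp y"
    proof (rule mult_left_mono)
      have "1 - y + y\<^sup>2 = (1 - y/2)\<^sup>2 + 3/4 * y\<^sup>2"
        by (simp add: power2_eq_square field_simps)
      then show "0 \<le> 1 - y + y\<^sup>2" by simp
    qed (use y exp_lower_Taylor_quadratic[of y] in auto)
    finally have "exp (- y) \<le> 1 - y + y\<^sup>2"
      by (simp add: exp_minus field_simps)
    then show ?thesis
      by (intro quad) (simp add: y_def)
  next
    case 2
    then show ?thesis by (intro quad exp_bound)
  next
    case 3
    then have "x \<le> x\<^sup>2"
      by (simp add: power2_eq_square)
    then have "exp x \<le> exp (x\<^sup>2)" by simp
    with 3 show ?thesis by linarith
  qed
qed

text \<open>After centring at the mean \<mu>, the linear term of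
  \<open>exp_le_add_exp_square\<close> averages to zero. Each x i and \<mu> are at most sqrt T in
  absolute value, so centred values have square at most 4 T; this is the factor 4.\<close>

lemma ln_sum_exp_le:
  assumes l: "l \<in> prob_simplex"
  shows "ln (\<Sum>i\<in>UNIV. l $ i * exp (x i)) \<le> (\<Sum>i\<in>UNIV. l $ i * x i) + 4 * (\<Sum>i\<in>UNIV. (x i)\<^sup>2)"
proof -
  define \<mu> where "\<mu> = (\<Sum>i\<in>UNIV. l $ i * x i)"
  define T where "T = (\<Sum>i\<in>UNIV. (x i)\<^sup>2)"
  have T: "0 \<le> T" unfolding T_def by (simp add: sum_nonneg)
  have x: "\<bar>x i\<bar> \<le> sqrt T" for i
    unfolding T_def using member_le_sum[of i UNIV "\<lambda>i. (x i)\<^sup>2"] by (intro real_le_rsqrt) simp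
  have "\<mu> \<le> sqrt T" "- \<mu> \<le> sqrt T"
    unfolding \<mu>_def using prob_simplex_average_le[OF l, of x "sqrt T"]
      prob_simplex_average_le[OF l, of "\<lambda>i. - x i" "sqrt T"] x
    by (auto simp: abs_le_iff sum_negf)
  then have "\<bar>x i - \<mu>\<bar> \<le> 2 * sqrt T" for i
    using x[of i] by linarith
  then have sq: "(x i - \<mu>)\<^sup>2 \<le> 4 * T" for i
    using power_mono[of "\<bar>x i - \<mu>\<bar>" "2 * sqrt T" 2 for i] T by (auto simp: power_mult_distrib)
  have pos: "0 < (\<Sum>i\<in>UNIV. l $ i * exp (x i))"
  proof -
    obtain j where "0 < l $ j"
      using prob_simplexD(1,2)[OF l] by (metis less_eq_real_def sum.neutral zero_neq_one)
    then show ?thesis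
      using prob_simplexD(1)[OF l] by (intro sum_pos2[of _ j]) auto
  qed
  have "(\<Sum>i\<in>UNIV. l $ i * exp (x i)) * exp (- \<mu>) = (\<Sum>i\<in>UNIV. l $ i * exp (x i - \<mu>))"
    by (simp add: sum_distrib_right exp_diff exp_minus divide_inverse mult.assoc)
  also have "\<dots> \<le> (\<Sum>i\<in>UNIV. l $ i * ((x i - \<mu>) + exp (4 * T)))"
  proof (intro sum_mono mult_left_mono)
    show "exp (x i - \<mu>) \<le> x i - \<mu> + exp (4 * T)" for i
      using exp_le_add_exp_square[of "x i - \<mu>"] sq[of i] by (smt (verit) exp_le_cancel_iff)
  qed (use prob_simplexD(1)[OF l] in auto)
  also have "\<dots> = (\<Sum>i\<in>UNIV. l $ i * x i) + (\<Sum>i\<in>UNIV. l $ i) * (exp (4 * T) - \<mu>)"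
    unfolding sum_distrib_right by (simp add: algebra_simps sum.distrib sum_subtractf sum_distrib_left)
  also have "\<dots> = exp (4 * T)"
    using prob_simplexD(2)[OF l] by (simp add: \<mu>_def)
  finally have "(\<Sum>i\<in>UNIV. l $ i * exp (x i)) \<le> exp (\<mu> + 4 * T)"
    by (simp add: exp_minus exp_add field_simps)
  then have "ln (\<Sum>i\<in>UNIV. l $ i * exp (x i)) \<le> ln (exp (\<mu> + 4 * T))"
    using pos by (subst ln_le_cancel_iff) auto
  then show ?thesis by (simp add: \<mu>_def T_def)
qed

section \<open>The divergence in closed form and the prox step\<close>

definition msmd_div :: "real \<Rightarrow> (real^'n) \<times> (real^'m) \<Rightarrow> (real^'n) \<times> (real^'m) \<Rightarrow> real" where
  "msmd_div C z u = (norm (fst u - fst z))\<^sup>2 / (2 * C\<^sup>2) + kl (snd u) (snd z) / (2 * ln (real CARD('m)))"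

lemma GDERIV_omega_z:
  fixes d :: "real^'n" and l :: "real^'m"
  assumes "\<And>i. 0 < l $ i"
  shows "GDERIV (omega_z C) (d, l) :>
    ((1 / C\<^sup>2) *\<^sub>R d, (\<chi> i. 1 / (2 * ln (real CARD('m))) * (ln (l $ i) + 1)))"
proof -
  define \<kappa> where "\<kappa> = 1 / (2 * ln (real CARD('m)))"
  have ent: "((\<lambda>z::(real^'n) \<times> (real^'m). snd z $ i * ln (snd z $ i))
      has_derivative (\<lambda>h. (ln (l $ i) + 1) * (snd h $ i))) (at (d, l))" for i
  proof -
    have "((\<lambda>t. t * ln t) has_real_derivative ln (l $ i) + 1) (at (l $ i))"
      using assms[of i] by (auto intro!: derivative_eq_intros)
    moreover have "((\<lambda>z::(real^'n) \<times> (real^'m). snd z $ i) has_derivative (\<lambda>h. snd h $ i)) (at (d, l))"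
      by (intro bounded_linear.has_derivative[OF bounded_linear_vec_nth] has_derivative_snd has_derivative_ident)
    ultimately show ?thesis
      using has_derivative_compose[of "\<lambda>z::(real^'n) \<times> (real^'m). snd z $ i" "\<lambda>h. snd h $ i" "(d, l)" UNIV
          "\<lambda>t. t * ln t" "(*) (ln (l $ i) + 1)"]
      by (simp add: has_field_derivative_def)
  qed
  have "((\<lambda>z::(real^'n) \<times> (real^'m). 1 / (2 * C\<^sup>2) * (fst z \<bullet> fst z)
        + \<kappa> * (\<Sum>i\<in>UNIV. snd z $ i * ln (snd z $ i)))
      has_derivative (\<lambda>h. 1 / (2 * C\<^sup>2) * (d \<bullet> fst h + fst h \<bullet> d)
        + \<kappa> * (\<Sum>i\<in>UNIV. (ln (l $ i) + 1) * (snd h $ i)))) (at (d, l))"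
    by (rule derivative_eq_intros ent refl | simp)+
  then show ?thesis
    unfolding gderiv_def omega_z_def \<kappa>_def[symmetric]
    by (simp add: case_prod_unfold power2_norm_eq_inner inner_prod_def inner_vec_def
        inner_commute sum_distrib_left sum_divide_distrib mult_ac)
qed

text \<open>The summand 1 in the derivative of t ln t contributes only the difference of the total
  masses, which vanishes on the simplex. The base point is the first argument of
  \<open>msmd_div\<close> but the second argument of \<open>kl\<close>.\<close>

lemma bregman_omega_z:
  fixes d e :: "real^'n" and l p :: "real^'m"
  assumes l: "l \<in> prob_simplex" "\<And>i. 0 < l $ i" and p: "p \<in> prob_simplex"
  shows "bregman (omega_z C) (d, l) (e, p) = msmd_div C (d, l) (e, p)"
proof -
  define \<kappa> where "\<kappa> = 1 / (2 * ln (real CARD('m)))"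
  have ent: "(\<Sum>i\<in>UNIV. p $ i * ln (p $ i)) - (\<Sum>i\<in>UNIV. l $ i * ln (l $ i))
      - (\<Sum>i\<in>UNIV. (ln (l $ i) + 1) * (p $ i - l $ i)) = kl p l"
  proof -
    have "(\<Sum>i\<in>UNIV. p $ i * ln (p $ i)) - (\<Sum>i\<in>UNIV. l $ i * ln (l $ i))
      - (\<Sum>i\<in>UNIV. (ln (l $ i) + 1) * (p $ i - l $ i))
      = kl p l - ((\<Sum>i\<in>UNIV. p $ i) - (\<Sum>i\<in>UNIV. l $ i))"
      unfolding kl_def by (simp add: algebra_simps sum_subtractf sum.distrib)
    then show ?thesis
      using prob_simplexD(2)[OF l(1)] prob_simplexD(2)[OF p] by simp
  qed
  have g: "grad (omega_z C) (d, l) \<bullet> ((e, p) - (d, l))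
      = 1 / C\<^sup>2 * (d \<bullet> (e - d)) + \<kappa> * (\<Sum>i\<in>UNIV. (ln (l $ i) + 1) * (p $ i - l $ i))"
    unfolding grad_eqI[OF GDERIV_omega_z[of l, OF l(2)]] \<kappa>_def
    by (simp add: inner_vec_def sum_distrib_left mult_ac)
  have "bregman (omega_z C) (d, l) (e, p)
    = (1 / (2 * C\<^sup>2) * (norm e)\<^sup>2 - 1 / (2 * C\<^sup>2) * (norm d)\<^sup>2 - 1 / C\<^sup>2 * (d \<bullet> (e - d)))
      + \<kappa> * ((\<Sum>i\<in>UNIV. p $ i * ln (p $ i)) - (\<Sum>i\<in>UNIV. l $ i * ln (l $ i))
      - (\<Sum>i\<in>UNIV. (ln (l $ i) + 1) * (p $ i - l $ i)))"
    unfolding bregman_def g unfolding omega_z_def \<kappa>_def by (simp add: algebra_simps diff_divide_distrib)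
  \<comment> \<open>For C = 0 both sides are 0, since division by zero yields 0.\<close>
  also have "1 / (2 * C\<^sup>2) * (norm e)\<^sup>2 - 1 / (2 * C\<^sup>2) * (norm d)\<^sup>2 - 1 / C\<^sup>2 * (d \<bullet> (e - d))
    = (norm (e - d))\<^sup>2 / (2 * C\<^sup>2)"
    by (cases "C = 0") (simp_all add: power2_norm_eq_inner inner_diff_left inner_diff_right inner_commute field_simps)
  finally show ?thesis
    unfolding ent msmd_div_def \<kappa>_def by simp
qed

text \<open>The exponential-weights update. The factor 2 ln m inverts the weight 1 / (2 ln m) of the
  entropy in \<open>omega_z\<close>.\<close>

definition softmax_step :: "real^'m \<Rightarrow> real^'m \<Rightarrow> real^'m" where
  "softmax_step l b = (\<chi> i. l $ i * exp (- 2 * ln (real CARD('m)) * b $ i)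
     / (\<Sum>j\<in>UNIV. l $ j * exp (- 2 * ln (real CARD('m)) * b $ j)))"

lemma softmax_step_simplex:
  fixes l b :: "real^'m"
  assumes "\<And>i. 0 < l $ i"
  shows "softmax_step l b \<in> prob_simplex" "\<And>i. 0 < softmax_step l b $ i"
proof -
  have "0 < (\<Sum>j\<in>UNIV. l $ j * exp (- 2 * ln (real CARD('m)) * b $ j))"
    using assms by (intro sum_pos) auto
  then show "\<And>i. 0 < softmax_step l b $ i" "softmax_step l b \<in> prob_simplex"
    using assms by (auto simp: softmax_step_def prob_simplex_def less_imp_le
        simp flip: sum_divide_distrib)
qed

text \<open>The logarithm of the new weights is the old one plus a linear term minus the log of the
  normaliser, which is constant in i. The resulting identity is exact for every p, so it yields both
  the optimality of the step and its effect on the Lyapunov function.\<close>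

lemma kl_softmax_step:
  fixes l b p :: "real^'m"
  assumes "\<And>i. 0 < l $ i" "p \<in> prob_simplex"
  shows "kl p (softmax_step l b) = kl p l + 2 * ln (real CARD('m)) * (b \<bullet> p)
    + ln (\<Sum>j\<in>UNIV. l $ j * exp (- 2 * ln (real CARD('m)) * b $ j))"
proof -
  define W where "W = (\<Sum>j\<in>UNIV. l $ j * exp (- 2 * ln (real CARD('m)) * b $ j))"
  have W: "0 < W"
    unfolding W_def using assms by (intro sum_pos) auto
  have ln_step: "ln (softmax_step l b $ i) = ln (l $ i) - 2 * ln (real CARD('m)) * b $ i - ln W" for i
    unfolding softmax_step_def W_def[symmetric] using W assms(1)[of i] by (simp add: ln_div ln_mult)
  have "p $ i * (ln (p $ i) - ln (softmax_step l b $ i)) = p $ i * (ln (p $ i) - ln (l $ i))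
      + 2 * ln (real CARD('m)) * (b $ i * p $ i) + ln W * p $ i" for i
    unfolding ln_step by (simp add: algebra_simps)
  then have "kl p (softmax_step l b) = (\<Sum>i\<in>UNIV. p $ i * (ln (p $ i) - ln (l $ i))
      + 2 * ln (real CARD('m)) * (b $ i * p $ i) + ln W * p $ i)"
    unfolding kl_def by simp
  also have "\<dots> = kl p l + 2 * ln (real CARD('m)) * (b \<bullet> p) + ln W * (\<Sum>i\<in>UNIV. p $ i)"
    by (simp add: sum.distrib kl_def inner_vec_def sum_distrib_left)
  finally show ?thesis
    using prob_simplexD(2)[OF assms(2)] by (simp add: W_def)
qed

text \<open>The objective separates. Completing the square in d leaves the distance to d - C^2 a,
  minimised by projection; \<open>kl_softmax_step\<close> completes the entropy part in the same
  way, leaving a multiple of kl p q. The remainder \<open>K\<close> is independent of the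
  minimisation variable.\<close>

lemma prox_map_eq:
  fixes d a :: "real^'n" and l b :: "real^'m"
  assumes m: "CARD('m) \<ge> 2" and C: "0 < C"
    and l: "l \<in> prob_simplex" "\<And>i. 0 < l $ i"
  shows "prox_map C (d, l) (a, b) = (closest_point (cball 0 C) (d - C\<^sup>2 *\<^sub>R a), softmax_step l b)"
proof -
  define w where "w = d - C\<^sup>2 *\<^sub>R a"
  define c where "c = closest_point (cball 0 C) w"
  define q where "q = softmax_step l b"
  define \<kappa> where "\<kappa> = 1 / (2 * ln (real CARD('m)))"
  have \<kappa>: "0 < \<kappa>" "\<kappa> * (2 * ln (real CARD('m))) = 1"
    using m by (auto simp: \<kappa>_def)
  define K where "K = C\<^sup>2 / 2 * (norm a)\<^sup>2 + b \<bullet> l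
    + \<kappa> * ln (\<Sum>j\<in>UNIV. l $ j * exp (- 2 * ln (real CARD('m)) * b $ j))"
  have c: "c \<in> cball 0 C"
    unfolding c_def using C by (intro closest_point_in_set) auto
  have q: "q \<in> prob_simplex" "\<And>i. 0 < q $ i"
    unfolding q_def using softmax_step_simplex[of l] l(2) by auto
  have obj: "(a, b) \<bullet> ((e, p) - (d, l)) + bregman (omega_z C) (d, l) (e, p)
      = (norm (e - w))\<^sup>2 / (2 * C\<^sup>2) + \<kappa> * kl p q - K" if "p \<in> prob_simplex" for e p
  proof -
    have 1: "a \<bullet> (e - d) + (norm (e - d))\<^sup>2 / (2 * C\<^sup>2) = (norm (e - w))\<^sup>2 / (2 * C\<^sup>2) - C\<^sup>2 / 2 * (norm a)\<^sup>2"
    proof -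
      have "(norm (e - w))\<^sup>2 = (norm (e - d))\<^sup>2 + 2 * C\<^sup>2 * (a \<bullet> (e - d)) + (C\<^sup>2)\<^sup>2 * (norm a)\<^sup>2"
        unfolding w_def power2_norm_eq_inner
        by (simp add: inner_diff_left inner_diff_right inner_commute power2_eq_square algebra_simps)
      then show ?thesis
        using C by (simp add: field_simps power2_eq_square)
    qed
    have 2: "b \<bullet> (p - l) + \<kappa> * kl p l = \<kappa> * kl p q - (b \<bullet> l
      + \<kappa> * ln (\<Sum>j\<in>UNIV. l $ j * exp (- 2 * ln (real CARD('m)) * b $ j)))"
      unfolding q_def kl_softmax_step[of l, OF l(2) that]
      using \<kappa>(2) by (simp add: inner_diff_right algebra_simps)
    show ?thesis
      unfolding bregman_omega_z[OF l that] msmd_div_def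
      using 1 2 by (simp add: K_def \<kappa>_def)
  qed
  have closer: "norm (c - w) < norm (e - w)" if "e \<in> cball 0 C" "e \<noteq> c" for e
    using closest_point_lt[of "cball 0 C" e w] that
    by (simp add: c_def dist_norm norm_minus_commute)
  show ?thesis
    unfolding prox_map_def w_def[symmetric] c_def[symmetric] q_def[symmetric]
  proof (rule arg_min_on_unique)
    show "(c, q) \<in> Z_set C"
      using c q by (simp add: Z_set_def)
    fix u assume u: "u \<in> Z_set C" "u \<noteq> (c, q)"
    obtain e p where ep: "u = (e, p)" by (cases u)
    have mem: "e \<in> cball 0 C" "p \<in> prob_simplex"
      using u by (auto simp: Z_set_def ep)
    have strict: "(norm (c - w))\<^sup>2 / (2 * C\<^sup>2) < (norm (e - w))\<^sup>2 / (2 * C\<^sup>2)" if "e \<noteq> c"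
      using C by (intro divide_strict_right_mono power_strict_mono closer mem that) auto
    then have "(norm (c - w))\<^sup>2 / (2 * C\<^sup>2) \<le> (norm (e - w))\<^sup>2 / (2 * C\<^sup>2)"
      by fastforce
    moreover note strict
    moreover have "0 \<le> \<kappa> * kl p q" "p \<noteq> q \<Longrightarrow> 0 < \<kappa> * kl p q"
      using kl_nonneg[OF mem(2) q] kl_pos_strict[OF mem(2) q] \<kappa> by auto
    moreover have "e \<noteq> c \<or> p \<noteq> q"
      using u ep by auto
    ultimately show "(a, b) \<bullet> ((c, q) - (d, l)) + bregman (omega_z C) (d, l) (c, q)
        < (a, b) \<bullet> (u - (d, l)) + bregman (omega_z C) (d, l) u"
      unfolding ep obj[OF mem(2)] obj[OF q(1)] by (auto simp: kl_def)
  qed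
qed

text \<open>The two parts are estimated differently: projection onto the ball is nonexpansive and
  fixes e, while the entropy part is the exact identity with its normaliser bounded by
  \<open>ln_sum_exp_le\<close>. The constant 8 ln m is 4 (2 ln m)^2 divided by 2 ln m.\<close>

lemma msmd_div_prox_map_le:
  fixes d a e :: "real^'n" and l b p :: "real^'m"
  assumes m: "CARD('m) \<ge> 2" and C: "0 < C"
    and l: "l \<in> prob_simplex" "\<And>i. 0 < l $ i"
    and e: "norm e \<le> C" and p: "p \<in> prob_simplex"
  shows "msmd_div C (prox_map C (d, l) (\<gamma> *\<^sub>R (a, b))) (e, p)
    \<le> msmd_div C (d, l) (e, p) - \<gamma> * ((a, b) \<bullet> ((d, l) - (e, p)))
      + \<gamma>\<^sup>2 * (C\<^sup>2 / 2 * (norm a)\<^sup>2 + 8 * ln (real CARD('m)) * (norm b)\<^sup>2)"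
proof -
  define \<kappa> where "\<kappa> = 1 / (2 * ln (real CARD('m)))"
  have \<kappa>: "0 < \<kappa>" "\<kappa> * (2 * ln (real CARD('m))) = 1"
    using m by (auto simp: \<kappa>_def)
  define d' where "d' = closest_point (cball 0 C) (d - C\<^sup>2 *\<^sub>R \<gamma> *\<^sub>R a)"
  have 1: "(norm (e - d'))\<^sup>2 / (2 * C\<^sup>2)
    \<le> (norm (e - d))\<^sup>2 / (2 * C\<^sup>2) - \<gamma> * (a \<bullet> (d - e)) + \<gamma>\<^sup>2 * (C\<^sup>2 / 2 * (norm a)\<^sup>2)"
  proof -
    have "dist (closest_point (cball 0 C) e) d' \<le> dist e (d - C\<^sup>2 *\<^sub>R \<gamma> *\<^sub>R a)"
      unfolding d'_def using C by (intro closest_point_lipschitz) auto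
    then have "norm (e - d') \<le> norm (e - (d - C\<^sup>2 *\<^sub>R \<gamma> *\<^sub>R a))"
      using e by (simp add: closest_point_self dist_norm)
    then have "(norm (e - d'))\<^sup>2 \<le> (norm (e - (d - C\<^sup>2 *\<^sub>R \<gamma> *\<^sub>R a)))\<^sup>2"
      by (intro power_mono) auto
    also have "\<dots> = (norm (e - d))\<^sup>2 - 2 * C\<^sup>2 * (\<gamma> * (a \<bullet> (d - e))) + \<gamma>\<^sup>2 * (C\<^sup>2)\<^sup>2 * (norm a)\<^sup>2"
      unfolding power2_norm_eq_inner
      by (simp add: inner_diff_left inner_diff_right inner_commute power2_eq_square algebra_simps)
    finally have "(norm (e - d'))\<^sup>2 / (2 * C\<^sup>2) \<le> ((norm (e - d))\<^sup>2
        - 2 * C\<^sup>2 * (\<gamma> * (a \<bullet> (d - e))) + \<gamma>\<^sup>2 * (C\<^sup>2)\<^sup>2 * (norm a)\<^sup>2) / (2 * C\<^sup>2)"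
      by (intro divide_right_mono) auto
    also have "\<dots> = (norm (e - d))\<^sup>2 / (2 * C\<^sup>2) - \<gamma> * (a \<bullet> (d - e)) + \<gamma>\<^sup>2 * (C\<^sup>2 / 2 * (norm a)\<^sup>2)"
      using C by (simp add: field_simps power2_eq_square)
    finally show ?thesis .
  qed
  have 2: "\<kappa> * kl p (softmax_step l (\<gamma> *\<^sub>R b))
    \<le> \<kappa> * kl p l - \<gamma> * (b \<bullet> (l - p)) + \<gamma>\<^sup>2 * (8 * ln (real CARD('m)) * (norm b)\<^sup>2)"
  proof -
    define W where "W = ln (\<Sum>j\<in>UNIV. l $ j * exp (- 2 * ln (real CARD('m)) * (\<gamma> *\<^sub>R b) $ j))"
    define x where "x i = - 2 * ln (real CARD('m)) * (\<gamma> *\<^sub>R b) $ i" for i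
    have "W \<le> (\<Sum>i\<in>UNIV. l $ i * x i) + 4 * (\<Sum>i\<in>UNIV. (x i)\<^sup>2)"
      unfolding W_def x_def by (rule ln_sum_exp_le[OF l(1)])
    also have "(\<Sum>i\<in>UNIV. l $ i * x i) = - (2 * ln (real CARD('m))) * (\<gamma> * (b \<bullet> l))"
      unfolding x_def inner_vec_def by (simp add: sum_distrib_left mult_ac sum_negf)
    also have "(\<Sum>i\<in>UNIV. (x i)\<^sup>2) = (2 * ln (real CARD('m))) * (2 * ln (real CARD('m))) * \<gamma>\<^sup>2 * (norm b)\<^sup>2"
      unfolding x_def power2_norm_eq_inner inner_vec_def
      by (simp add: sum_distrib_left power2_eq_square mult_ac)
    finally have "\<kappa> * W \<le> \<kappa> * (- (2 * ln (real CARD('m))) * (\<gamma> * (b \<bullet> l))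
      + 4 * ((2 * ln (real CARD('m))) * (2 * ln (real CARD('m))) * \<gamma>\<^sup>2 * (norm b)\<^sup>2))"
      using \<kappa> by (intro mult_left_mono) auto
    also have "\<dots> = (\<kappa> * (2 * ln (real CARD('m)))) * (- \<gamma> * (b \<bullet> l)
      + 4 * ((2 * ln (real CARD('m))) * \<gamma>\<^sup>2 * (norm b)\<^sup>2))"
      by (simp add: algebra_simps)
    finally have "\<kappa> * W \<le> - \<gamma> * (b \<bullet> l) + \<gamma>\<^sup>2 * (8 * ln (real CARD('m)) * (norm b)\<^sup>2)"
      unfolding \<kappa>(2) by (simp add: algebra_simps)
    moreover have "\<kappa> * kl p (softmax_step l (\<gamma> *\<^sub>R b))
      = \<kappa> * kl p l + (\<kappa> * (2 * ln (real CARD('m)))) * (\<gamma> * (b \<bullet> p)) + \<kappa> * W"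
      unfolding kl_softmax_step[of l, OF l(2) p] W_def by (simp add: algebra_simps)
    ultimately show ?thesis
      unfolding \<kappa>(2) by (simp add: inner_diff_right algebra_simps)
  qed
  show ?thesis
    unfolding msmd_div_def scaleR_Pair prox_map_eq[of C l, OF m C l] d'_def[symmetric]
    using 1 2 by (simp add: \<kappa>_def algebra_simps)
qed

subsection \<open>The inner loop\<close>

text \<open>Fubini for the joint law, which is a product by independence. It replaces conditioning
  on X: the inner integral averages over Y alone.\<close>

lemma (in prob_space) indep_var_freeze:
  fixes h :: "'b \<times> 'b \<Rightarrow> real"
  assumes ind: "indep_var S X T Y" and h[measurable]: "h \<in> borel_measurable (S \<Otimes>\<^sub>M T)"
    and int: "integrable M (\<lambda>\<omega>. h (X \<omega>, Y \<omega>))"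
  shows "integrable M (\<lambda>\<omega>'. \<integral>\<omega>. h (X \<omega>', Y \<omega>) \<partial>M)"
    and "(\<integral>\<omega>'. (\<integral>\<omega>. h (X \<omega>', Y \<omega>) \<partial>M) \<partial>M) = (\<integral>\<omega>. h (X \<omega>, Y \<omega>) \<partial>M)"
proof -
  have X[measurable]: "X \<in> measurable M S" and Y[measurable]: "Y \<in> measurable M T"
    using ind indep_var_rv1 indep_var_rv2 by blast+
  interpret P: prob_space "distr M S X" by (rule prob_space_distr) fact
  interpret R: prob_space "distr M T Y" by (rule prob_space_distr) fact
  interpret PR: pair_prob_space "distr M S X" "distr M T Y" ..
  have eq: "distr M S X \<Otimes>\<^sub>M distr M T Y = distr M (S \<Otimes>\<^sub>M T) (\<lambda>x. (X x, Y x))"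
    using ind indep_var_distribution_eq by blast
  have int': "integrable (distr M S X \<Otimes>\<^sub>M distr M T Y) h"
    unfolding eq using int by (subst integrable_distr_eq) auto
  have sec: "(\<integral>y. h (x, y) \<partial>distr M T Y) = (\<integral>\<omega>. h (x, Y \<omega>) \<partial>M)" if "x \<in> space S" for x
    using that by (intro integral_distr) auto
  have "integrable (distr M S X) (\<lambda>x. \<integral>y. h (x, y) \<partial>distr M T Y)"
    by (rule PR.integrable_fst'[OF int'])
  then have 1: "integrable M (\<lambda>\<omega>'. \<integral>y. h (X \<omega>', y) \<partial>distr M T Y)"
    by (subst (asm) integrable_distr_eq) auto
  have eqM: "(\<integral>y. h (X \<omega>', y) \<partial>distr M T Y) = (\<integral>\<omega>. h (X \<omega>', Y \<omega>) \<partial>M)" if "\<omega>' \<in> space M" for \<omega>'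
    using that by (intro sec) (rule measurable_space[OF X])
  show "integrable M (\<lambda>\<omega>'. \<integral>\<omega>. h (X \<omega>', Y \<omega>) \<partial>M)"
    using 1 eqM by (simp cong: Bochner_Integration.integrable_cong)
  have "(\<integral>\<omega>'. (\<integral>\<omega>. h (X \<omega>', Y \<omega>) \<partial>M) \<partial>M) = (\<integral>\<omega>'. (\<integral>y. h (X \<omega>', y) \<partial>distr M T Y) \<partial>M)"
    by (intro Bochner_Integration.integral_cong) (auto simp: eqM)
  also have "\<dots> = (\<integral>x. (\<integral>y. h (x, y) \<partial>distr M T Y) \<partial>distr M S X)"
    by (intro integral_distr[symmetric]) auto
  also have "\<dots> = integral\<^sup>L (distr M S X \<Otimes>\<^sub>M distr M T Y) h"
    by (rule PR.integral_fst'[OF int'])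
  also have "\<dots> = (\<integral>\<omega>. h (X \<omega>, Y \<omega>) \<partial>M)"
    unfolding eq by (intro integral_distr) auto
  finally show "(\<integral>\<omega>'. (\<integral>\<omega>. h (X \<omega>', Y \<omega>) \<partial>M) \<partial>M) = (\<integral>\<omega>. h (X \<omega>, Y \<omega>) \<partial>M)" .
qed

text \<open>X and Y are functions of disjoint blocks of one family. Composing h with these functions
  moves the claim to the product spaces of the blocks, where the independence of restrictions
  applies.\<close>

lemma (in prob_space) indep_vars_freeze:
  fixes h :: "'c \<times> 'd \<Rightarrow> real"
  assumes ind: "indep_vars N \<xi> I" and AB: "A \<inter> B = {}" "A \<subseteq> I" "B \<subseteq> I"
    and F[measurable]: "F \<in> measurable (PiM A N) S" and H[measurable]: "H \<in> measurable (PiM B N) T"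
    and X: "\<And>\<omega>. X \<omega> = F (restrict (\<lambda>i. \<xi> i \<omega>) A)" and Y: "\<And>\<omega>. Y \<omega> = H (restrict (\<lambda>i. \<xi> i \<omega>) B)"
    and h[measurable]: "h \<in> borel_measurable (S \<Otimes>\<^sub>M T)"
    and int: "integrable M (\<lambda>\<omega>. h (X \<omega>, Y \<omega>))"
  shows "integrable M (\<lambda>\<omega>'. \<integral>\<omega>. h (X \<omega>', Y \<omega>) \<partial>M)"
    and "(\<integral>\<omega>'. (\<integral>\<omega>. h (X \<omega>', Y \<omega>) \<partial>M) \<partial>M) = (\<integral>\<omega>. h (X \<omega>, Y \<omega>) \<partial>M)"
proof -
  have m: "(\<lambda>(a, b). h (F a, H b)) \<in> borel_measurable (PiM A N \<Otimes>\<^sub>M PiM B N)"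
    by measurable
  show "integrable M (\<lambda>\<omega>'. \<integral>\<omega>. h (X \<omega>', Y \<omega>) \<partial>M)"
    using indep_var_freeze(1)[OF indep_var_restrict[OF ind AB] m] int by (simp add: X Y)
  show "(\<integral>\<omega>'. (\<integral>\<omega>. h (X \<omega>', Y \<omega>) \<partial>M) \<partial>M) = (\<integral>\<omega>. h (X \<omega>, Y \<omega>) \<partial>M)"
    using indep_var_freeze(2)[OF indep_var_restrict[OF ind AB] m] int by (simp add: X Y)
qed

section \<open>Invariants and measurability of the inner iterates\<close>

lemma borel_measurable_vec:
  fixes F :: "'w \<Rightarrow> real^'n"
  assumes "\<And>i. (\<lambda>\<omega>. F \<omega> $ i) \<in> borel_measurable N"
  shows "F \<in> borel_measurable N"
proof (subst borel_measurable_euclidean_space, rule ballI)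
  fix b :: "real^'n" assume "b \<in> Basis"
  then obtain j where "b = axis j 1"
    by (auto simp: Basis_vec_def)
  then show "(\<lambda>\<omega>. F \<omega> \<bullet> b) \<in> borel_measurable N"
    using assms[of j] by (simp add: inner_axis)
qed

lemma borel_measurable_vec_nth[measurable (raw)]:
  fixes F :: "'w \<Rightarrow> real^'n"
  assumes "F \<in> borel_measurable N"
  shows "(\<lambda>\<omega>. F \<omega> $ i) \<in> borel_measurable N"
  by (rule measurable_compose[OF assms borel_measurable_continuous_onI]) (intro continuous_intros)

lemma borel_measurable_fst_snd:
  fixes F :: "'w \<Rightarrow> 'b::second_countable_topology \<times> 'c::second_countable_topology"
  assumes "F \<in> borel_measurable N"
  shows "(\<lambda>\<omega>. fst (F \<omega>)) \<in> borel_measurable N" "(\<lambda>\<omega>. snd (F \<omega>)) \<in> borel_measurable N"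
  by (rule measurable_compose[OF assms borel_measurable_continuous_onI], intro continuous_intros)+

lemma msmd_inner_cong:
  assumes "\<And>t. t < s \<Longrightarrow> g t = g' t"
  shows "msmd_inner C \<gamma> g s = msmd_inner C \<gamma> g' s"
  using assms by (induction s) auto

lemma msmd_inner_Suc:
  "msmd_inner C \<gamma> g (Suc s) =
    prox_map C (fst (msmd_inner C \<gamma> g s), snd (msmd_inner C \<gamma> g s))
      (\<gamma> s *\<^sub>R (fst (grad_phi (g s) (msmd_inner C \<gamma> g s)), snd (grad_phi (g s) (msmd_inner C \<gamma> g s))))"
  by simp

text \<open>Strict positivity of the weights is the decisive invariant: the gradient of
  \<open>omega_z\<close> exists only there, so the closed form of the prox step depends on
  it.\<close>

lemma msmd_inner_mem:
  fixes g :: "nat \<Rightarrow> 'm::finite \<Rightarrow> real^'n"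
  assumes "CARD('m) \<ge> 2" "0 < C"
  shows "snd (msmd_inner C \<gamma> g s) \<in> prob_simplex \<and> (\<forall>i. 0 < snd (msmd_inner C \<gamma> g s) $ i)
    \<and> norm (fst (msmd_inner C \<gamma> g s)) \<le> C"
proof (induction s)
  case 0
  then show ?case
    using assms by (auto simp: prob_simplex_def)
next
  case (Suc s)
  define z where "z = msmd_inner C \<gamma> g s"
  have proj: "closest_point (cball 0 C) w \<in> cball 0 C" for w :: "real^'n"
    using assms by (intro closest_point_in_set) auto
  have z: "snd z \<in> prob_simplex" "0 < snd z $ i" for i
    using Suc by (auto simp: z_def)
  show ?case
    unfolding msmd_inner_Suc scaleR_Pair z_def[symmetric] prox_map_eq[of C "snd z", OF assms z]
    using softmax_step_simplex[of "snd z", OF z(2)] proj by auto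
qed

text \<open>An \<open>arg_min_on\<close> is a choice and gives no measurability by itself. The
  closed form does: projection is continuous and the softmax is an explicit formula.\<close>

lemma msmd_inner_measurable:
  fixes g :: "'w \<Rightarrow> nat \<Rightarrow> 'm::finite \<Rightarrow> real^'n"
  assumes m: "CARD('m) \<ge> 2" "0 < C"
    and "\<And>t i. t < s \<Longrightarrow> (\<lambda>\<omega>. g \<omega> t i) \<in> borel_measurable N"
  shows "(\<lambda>\<omega>. msmd_inner C \<gamma> (g \<omega>) s) \<in> borel_measurable N"
  using assms(3)
proof (induction s)
  case 0
  then show ?case by simp
next
  case (Suc s)
  define z where "z \<omega> = msmd_inner C \<gamma> (g \<omega>) s" for \<omega>
  have z: "z \<in> borel_measurable N"
    unfolding z_def using Suc by auto
  note [measurable] = borel_measurable_fst_snd[OF z]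
  have [measurable]: "(\<lambda>\<omega>. g \<omega> s i) \<in> borel_measurable N" for i
    using Suc(2) by auto
  have [measurable]: "closest_point (cball (0::real^'n) C) \<in> borel_measurable borel"
    using m by (intro borel_measurable_continuous_onI continuous_on_closest_point) auto
  define a where "a \<omega> = fst (grad_phi (g \<omega> s) (z \<omega>))" for \<omega>
  define b where "b \<omega> = snd (grad_phi (g \<omega> s) (z \<omega>))" for \<omega>
  have a[measurable]: "a \<in> borel_measurable N"
    unfolding a_def grad_phi_def case_prod_unfold by simp
  have [measurable]: "(\<lambda>\<omega>. b \<omega> $ i) \<in> borel_measurable N" for i
    unfolding b_def grad_phi_def case_prod_unfold by simp
  have "(\<lambda>\<omega>. softmax_step (snd (z \<omega>)) (\<gamma> s *\<^sub>R b \<omega>)) \<in> borel_measurable N"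
    by (rule borel_measurable_vec) (simp add: softmax_step_def)
  moreover have "(\<lambda>\<omega>. closest_point (cball 0 C) (fst (z \<omega>) - C\<^sup>2 *\<^sub>R (\<gamma> s *\<^sub>R a \<omega>))) \<in> borel_measurable N"
    by measurable
  ultimately have "(\<lambda>\<omega>. (closest_point (cball 0 C) (fst (z \<omega>) - C\<^sup>2 *\<^sub>R (\<gamma> s *\<^sub>R a \<omega>)),
      softmax_step (snd (z \<omega>)) (\<gamma> s *\<^sub>R b \<omega>))) \<in> borel_measurable N"
    by (intro borel_measurable_Pair)
  moreover have "msmd_inner C \<gamma> (g \<omega>) (Suc s) = (closest_point (cball 0 C) (fst (z \<omega>) - C\<^sup>2 *\<^sub>R (\<gamma> s *\<^sub>R a \<omega>)),
      softmax_step (snd (z \<omega>)) (\<gamma> s *\<^sub>R b \<omega>))" for \<omega>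
    unfolding msmd_inner_Suc scaleR_Pair a_def b_def z_def
    using msmd_inner_mem[OF m, of \<gamma> "g \<omega>" s] by (intro prox_map_eq m) auto
  ultimately show ?case
    by simp
qed

section \<open>The inner loop at a frozen outer iterate, where \<open>h i\<close> stands for the
  oracle at that point\<close>

locale inner_loop = prob_space M
  for M :: "'w measure" +
  fixes Q :: "'x measure" and \<xi> :: "nat \<Rightarrow> 'w \<Rightarrow> 'x"
    and h :: "'m::finite \<Rightarrow> 'x \<Rightarrow> real^'n" and C \<gamma> :: real
  assumes card_ge_2: "CARD('m) \<ge> 2" and C_pos: "0 < C" and \<gamma>_pos: "0 < \<gamma>"
    and indep: "indep_vars (\<lambda>_. Q) \<xi> UNIV" and law: "\<And>s. distr M Q (\<xi> s) = Q"
    and h_measurable[measurable]: "\<And>i. h i \<in> borel_measurable Q"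
    and second_moment: "\<And>i. (\<integral>\<^sup>+ y. ennreal ((norm (h i y))\<^sup>2) \<partial>Q) \<le> ennreal (C\<^sup>2)"
begin

definition z :: "nat \<Rightarrow> 'w \<Rightarrow> (real^'n) \<times> (real^'m)" where
  "z s \<omega> = msmd_inner C (\<lambda>_. \<gamma>) (\<lambda>t i. h i (\<xi> t \<omega>)) s"

lemma z_Suc: "z (Suc s) \<omega> = prox_map C (fst (z s \<omega>), snd (z s \<omega>))
    (\<gamma> *\<^sub>R (fst (grad_phi (\<lambda>i. h i (\<xi> s \<omega>)) (z s \<omega>)), snd (grad_phi (\<lambda>i. h i (\<xi> s \<omega>)) (z s \<omega>))))"
  by (simp add: z_def)

lemma z_mem:
  "snd (z s \<omega>) \<in> prob_simplex" "0 < snd (z s \<omega>) $ i" "norm (fst (z s \<omega>)) \<le> C"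
  using msmd_inner_mem[OF card_ge_2 C_pos] by (auto simp: z_def)

lemma \<xi>_measurable[measurable]: "\<xi> s \<in> measurable M Q"
  using indep by (auto simp: indep_vars_def)

lemma z_measurable[measurable]: "z s \<in> borel_measurable M"
  unfolding z_def[abs_def] by (rule msmd_inner_measurable[OF card_ge_2 C_pos]) simp

lemma z_fst_snd_measurable[measurable]:
  "(\<lambda>\<omega>. fst (z s \<omega>)) \<in> borel_measurable M" "(\<lambda>\<omega>. snd (z s \<omega>)) \<in> borel_measurable M"
  by (rule borel_measurable_fst_snd[OF z_measurable])+

text \<open>By \<open>msmd_inner_cong\<close> the iterate at s depends only on samples before s,
  hence on a block disjoint from {s}. The fresh sample can thus be averaged with the iterate
  fixed.\<close>

lemma z_freeze:
  fixes k :: "((real^'n) \<times> (real^'m)) \<times> 'x \<Rightarrow> real"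
  assumes "k \<in> borel_measurable (borel \<Otimes>\<^sub>M Q)" "integrable M (\<lambda>\<omega>. k (z s \<omega>, \<xi> s \<omega>))"
  shows "(\<integral>\<omega>'. (\<integral>\<omega>. k (z s \<omega>', \<xi> s \<omega>) \<partial>M) \<partial>M) = (\<integral>\<omega>. k (z s \<omega>, \<xi> s \<omega>) \<partial>M)"
proof (rule indep_vars_freeze(2)[OF indep, of "{..<s}" "{s}"
      "\<lambda>y. msmd_inner C (\<lambda>_. \<gamma>) (\<lambda>t i. h i (y t)) s" borel "\<lambda>y. y s" Q])
  show "(\<lambda>y. msmd_inner C (\<lambda>_. \<gamma>) (\<lambda>t i. h i (y t)) s) \<in> borel_measurable (PiM {..<s} (\<lambda>_. Q))"
    by (rule msmd_inner_measurable[OF card_ge_2 C_pos]) simp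
  show "z s \<omega> = msmd_inner C (\<lambda>_. \<gamma>) (\<lambda>t i. h i ((\<lambda>t\<in>{..<s}. \<xi> t \<omega>) t)) s" for \<omega>
    unfolding z_def by (intro msmd_inner_cong) auto
qed (use assms in auto)

definition mean_grad :: "'m \<Rightarrow> real^'n" where
  "mean_grad i = (\<integral>y. h i y \<partial>Q)"

lemma sq_integrable:
  "integrable M (\<lambda>\<omega>. (norm (h i (\<xi> s \<omega>)))\<^sup>2)" "(\<integral>\<omega>. (norm (h i (\<xi> s \<omega>)))\<^sup>2 \<partial>M) \<le> C\<^sup>2"
proof -
  have "(\<integral>\<^sup>+ \<omega>. ennreal ((norm (h i (\<xi> s \<omega>)))\<^sup>2) \<partial>M)
      = (\<integral>\<^sup>+ y. ennreal ((norm (h i y))\<^sup>2) \<partial>distr M Q (\<xi> s))"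
    by (subst nn_integral_distr) auto
  then have le: "(\<integral>\<^sup>+ \<omega>. ennreal ((norm (h i (\<xi> s \<omega>)))\<^sup>2) \<partial>M) \<le> ennreal (C\<^sup>2)"
    using second_moment law by simp
  then show int: "integrable M (\<lambda>\<omega>. (norm (h i (\<xi> s \<omega>)))\<^sup>2)"
    by (intro integrableI_bounded) (auto simp: le_less_trans)
  then show "(\<integral>\<omega>. (norm (h i (\<xi> s \<omega>)))\<^sup>2 \<partial>M) \<le> C\<^sup>2"
    using le by (subst (asm) nn_integral_eq_integral) auto
qed

lemma h_integrable: "integrable M (\<lambda>\<omega>. h i (\<xi> s \<omega>))"
proof -
  have "integrable M (\<lambda>\<omega>. norm (h i (\<xi> s \<omega>)))"
    by (rule square_integrable_imp_integrable[OF _ sq_integrable(1)]) simp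
  then show ?thesis
    by (rule integrable_norm_cancel) simp
qed

lemma h_expectation: "(\<integral>\<omega>. h i (\<xi> s \<omega>) \<partial>M) = mean_grad i"
  using integral_distr[of "\<xi> s" M Q "h i"] law[of s] by (simp add: mean_grad_def)

text \<open>This places the saddle point in Z: its direction is minus a convex combination of the
  mean gradients.\<close>

lemma norm_mean_grad_le: "norm (mean_grad i) \<le> C"
proof -
  define X where "X \<omega> = norm (h i (\<xi> 0 \<omega>))" for \<omega>
  have int: "integrable M (\<lambda>\<omega>. (X \<omega>)\<^sup>2)" "integrable M X"
    using sq_integrable(1) h_integrable by (auto simp: X_def[abs_def])
  \<comment> \<open>The arithmetic-geometric mean inequality, tight at X = C, replaces Jensen and is
    linear in X^2, so only the second moment enters.\<close>
  have "X \<omega> \<le> ((X \<omega>)\<^sup>2 / C + C) / 2" for \<omega>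
    using C_pos zero_le_power2[of "X \<omega> - C"] by (simp add: field_simps power2_eq_square)
  then have "(\<integral>\<omega>. X \<omega> \<partial>M) \<le> (\<integral>\<omega>. ((X \<omega>)\<^sup>2 / C + C) / 2 \<partial>M)"
    using int by (intro integral_mono) auto
  also have "\<dots> = ((\<integral>\<omega>. (X \<omega>)\<^sup>2 \<partial>M) / C + C) / 2"
    using int by (simp add: prob_space)
  also have "\<dots> \<le> (C\<^sup>2 / C + C) / 2"
    using C_pos sq_integrable(2)[of i 0] by (intro divide_right_mono add_right_mono) (auto simp: X_def)
  also have "\<dots> = C"
    using C_pos by (simp add: power2_eq_square)
  finally have "(\<integral>\<omega>. X \<omega> \<partial>M) \<le> C" .
  then show ?thesis
    using integral_norm_bound[of M "\<lambda>\<omega>. h i (\<xi> 0 \<omega>)"] by (simp add: h_expectation X_def)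
qed

text \<open>Unbiasedness against a test vector that may depend on the current iterate. Boundedness
  of that vector supplies integrability.\<close>

lemma expectation_inner:
  assumes u[measurable]: "u \<in> borel_measurable borel" and bd: "\<And>\<omega>. norm (u (z s \<omega>)) \<le> B"
  shows "integrable M (\<lambda>\<omega>. h i (\<xi> s \<omega>) \<bullet> u (z s \<omega>))"
    and "integrable M (\<lambda>\<omega>. mean_grad i \<bullet> u (z s \<omega>))"
    and "(\<integral>\<omega>. h i (\<xi> s \<omega>) \<bullet> u (z s \<omega>) \<partial>M) = (\<integral>\<omega>. mean_grad i \<bullet> u (z s \<omega>) \<partial>M)"
proof -
  have uz: "(\<lambda>\<omega>. u (z s \<omega>)) \<in> borel_measurable M"
    by measurable
  have ineq: "\<bar>v \<bullet> u (z s \<omega>)\<bar> \<le> B * norm v" for v \<omega>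
  proof -
    have "\<bar>v \<bullet> u (z s \<omega>)\<bar> \<le> norm v * norm (u (z s \<omega>))"
      by (rule Cauchy_Schwarz_ineq2)
    also have "\<dots> \<le> norm v * B"
      using bd by (intro mult_left_mono) auto
    finally show ?thesis by (simp add: mult.commute)
  qed
  have B: "0 \<le> B"
    using bd norm_ge_zero order_trans by blast
  show int: "integrable M (\<lambda>\<omega>. h i (\<xi> s \<omega>) \<bullet> u (z s \<omega>))"
  proof (rule Bochner_Integration.integrable_bound)
    show "integrable M (\<lambda>\<omega>. B * norm (h i (\<xi> s \<omega>)))"
      using h_integrable by auto
    show "AE \<omega> in M. norm (h i (\<xi> s \<omega>) \<bullet> u (z s \<omega>)) \<le> norm (B * norm (h i (\<xi> s \<omega>)))"
      using ineq B by (auto simp: abs_mult)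
  qed (use uz in measurable)
  show "integrable M (\<lambda>\<omega>. mean_grad i \<bullet> u (z s \<omega>))"
    using ineq uz by (intro integrable_const_bound[where B="B * norm (mean_grad i)"]) auto
  have "(\<integral>\<omega>'. (\<integral>\<omega>. (\<lambda>(v, y). h i y \<bullet> u v) (z s \<omega>', \<xi> s \<omega>) \<partial>M) \<partial>M)
      = (\<integral>\<omega>. (\<lambda>(v, y). h i y \<bullet> u v) (z s \<omega>, \<xi> s \<omega>) \<partial>M)"
    using int by (intro z_freeze) auto
  then show "(\<integral>\<omega>. h i (\<xi> s \<omega>) \<bullet> u (z s \<omega>) \<partial>M) = (\<integral>\<omega>. mean_grad i \<bullet> u (z s \<omega>) \<partial>M)"
    using h_integrable by (simp add: h_expectation)
qed

end

text \<open>The terms l_i (g_i, d) cancel by skewness. The rest is arranged so that each stochastic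
  gradient is paired with one vector built from the iterate and the comparison point alone, the form
  required by \<open>expectation_inner\<close>.\<close>

lemma inner_grad_phi:
  fixes g :: "'m::finite \<Rightarrow> real^'n"
  shows "grad_phi g (d, l) \<bullet> ((d, l) - (e, p))
    = d \<bullet> (d - e) + (\<Sum>i\<in>UNIV. g i \<bullet> (p $ i *\<^sub>R d - l $ i *\<^sub>R e))"
proof -
  have "(\<chi> i. - (g i \<bullet> d)) \<bullet> (l - p) = (\<Sum>i\<in>UNIV. - (g i \<bullet> d) * (l $ i - p $ i))"
    unfolding inner_vec_def[of _ "l - p"] by simp
  then have "grad_phi g (d, l) \<bullet> ((d, l) - (e, p))
    = d \<bullet> (d - e) + ((\<Sum>i\<in>UNIV. l $ i * (g i \<bullet> (d - e))) + (\<Sum>i\<in>UNIV. - (g i \<bullet> d) * (l $ i - p $ i)))"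
    by (simp add: grad_phi_def inner_add_left inner_sum_left)
  also have "(\<Sum>i\<in>UNIV. l $ i * (g i \<bullet> (d - e))) + (\<Sum>i\<in>UNIV. - (g i \<bullet> d) * (l $ i - p $ i))
    = (\<Sum>i\<in>UNIV. g i \<bullet> (p $ i *\<^sub>R d - l $ i *\<^sub>R e))"
    unfolding sum.distrib[symmetric] by (intro sum.cong) (simp_all add: inner_diff_right algebra_simps)
  finally show ?thesis .
qed

lemma norm_grad_phi_le:
  fixes g :: "'m::finite \<Rightarrow> real^'n" and d :: "real^'n" and l :: "real^'m"
  assumes l: "l \<in> prob_simplex" and d: "norm d \<le> C"
  shows "(norm (fst (grad_phi g (d, l))))\<^sup>2 \<le> 2 * (\<Sum>i\<in>UNIV. (norm (g i))\<^sup>2) + 2 * C\<^sup>2"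
    and "(norm (snd (grad_phi g (d, l))))\<^sup>2 \<le> C\<^sup>2 * (\<Sum>i\<in>UNIV. (norm (g i))\<^sup>2)"
proof -
  define T where "T = (\<Sum>i\<in>UNIV. (norm (g i))\<^sup>2)"
  have T: "0 \<le> T" unfolding T_def by (simp add: sum_nonneg)
  have gT: "norm (g i) \<le> sqrt T" for i
    unfolding T_def using member_le_sum[of i UNIV "\<lambda>i. (norm (g i))\<^sup>2"] by (intro real_le_rsqrt) simp
  have "norm (\<Sum>i\<in>UNIV. l $ i *\<^sub>R g i) \<le> (\<Sum>i\<in>UNIV. norm (l $ i *\<^sub>R g i))"
    by (rule norm_sum)
  also have "\<dots> = (\<Sum>i\<in>UNIV. l $ i * norm (g i))"
    using prob_simplexD(1)[OF l] by simp
  also have "\<dots> \<le> sqrt T"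
    using l gT by (rule prob_simplex_average_le)
  finally have "norm (fst (grad_phi g (d, l))) \<le> sqrt T + C"
    using d norm_triangle_ineq[of "\<Sum>i\<in>UNIV. l $ i *\<^sub>R g i" d] by (simp add: grad_phi_def)
  then have "(norm (fst (grad_phi g (d, l))))\<^sup>2 \<le> (sqrt T + C)\<^sup>2"
    by (intro power_mono) auto
  also have "\<dots> \<le> 2 * T + 2 * C\<^sup>2"
    using T zero_le_power2[of "sqrt T - C"] by (simp add: power2_sum power2_diff)
  finally show "(norm (fst (grad_phi g (d, l))))\<^sup>2 \<le> 2 * (\<Sum>i\<in>UNIV. (norm (g i))\<^sup>2) + 2 * C\<^sup>2"
    by (simp add: T_def)
  have "(g i \<bullet> d)\<^sup>2 \<le> C\<^sup>2 * (norm (g i))\<^sup>2" for i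
  proof -
    have "\<bar>g i \<bullet> d\<bar> \<le> norm (g i) * norm d"
      by (rule Cauchy_Schwarz_ineq2)
    also have "\<dots> \<le> norm (g i) * C"
      using d by (intro mult_left_mono) auto
    finally have "\<bar>g i \<bullet> d\<bar>\<^sup>2 \<le> (norm (g i) * C)\<^sup>2"
      by (intro power_mono) auto
    then show ?thesis by (simp add: power_mult_distrib mult.commute)
  qed
  then show "(norm (snd (grad_phi g (d, l))))\<^sup>2 \<le> C\<^sup>2 * (\<Sum>i\<in>UNIV. (norm (g i))\<^sup>2)"
    unfolding grad_phi_def power2_norm_eq_inner[of "snd _"] inner_vec_def
    by (simp add: sum_distrib_left sum_mono flip: power2_eq_square)
qed

lemma kl_uniform_le:
  fixes p :: "real^'m"
  assumes p: "p \<in> prob_simplex"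
  shows "kl p (\<chi> i. 1 / real CARD('m)) \<le> ln (real CARD('m))"
proof -
  have "p $ i * (ln (p $ i) - ln (1 / real CARD('m))) \<le> p $ i * ln (real CARD('m))" for i
  proof (cases "p $ i = 0")
    case False
    then have "0 < p $ i" "p $ i \<le> 1"
      using prob_simplexD(1)[OF p, of i] prob_simplexD(3)[OF p, of i] by auto
    then show ?thesis
      by (intro mult_left_mono) (auto simp: ln_div)
  qed simp
  then have "kl p (\<chi> i. 1 / real CARD('m)) \<le> (\<Sum>i\<in>UNIV. p $ i * ln (real CARD('m)))"
    unfolding kl_def by (simp add: sum_mono)
  then show ?thesis
    using prob_simplexD(2)[OF p] by (simp flip: sum_distrib_right)
qed

lemma fst_weighted_avg_const:
  assumes "0 < \<gamma>" "P \<le> S"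
  shows "fst (weighted_avg (\<lambda>_. \<gamma>) z P S) = (1 / real (S - P + 1)) *\<^sub>R (\<Sum>s=P..S. fst (z s))"
proof -
  have "(\<Sum>s=P..S. \<gamma>) = real (S - P + 1) * \<gamma>"
    using assms by (simp add: Suc_diff_le)
  then show ?thesis
    using assms unfolding weighted_avg_def by (simp add: fst_sum flip: scaleR_sum_right)
qed

text \<open>Jensen for the squared norm, obtained from the triangle inequality and Cauchy-Schwarz
  for sums.\<close>

lemma norm_average_diff_le:
  fixes v :: "nat \<Rightarrow> 'a::real_normed_vector"
  assumes "P \<le> S"
  shows "(norm ((1 / real (S - P + 1)) *\<^sub>R (\<Sum>s=P..S. v s) - e))\<^sup>2
    \<le> (1 / real (S - P + 1)) * (\<Sum>s=P..S. (norm (v s - e))\<^sup>2)"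
proof -
  define N where "N = real (S - P + 1)"
  have N: "0 < N" "real (card {P..S}) = N"
    using assms by (auto simp: N_def Suc_diff_le)
  have "(\<Sum>s=P..S. v s - e) = (\<Sum>s=P..S. v s) - N *\<^sub>R e"
    using N(2) by (simp add: sum_subtractf sum_constant_scaleR)
  then have eq: "(1 / N) *\<^sub>R (\<Sum>s=P..S. v s) - e = (1 / N) *\<^sub>R (\<Sum>s=P..S. v s - e)"
    using N(1) by (simp add: scaleR_diff_right)
  have "(norm (\<Sum>s=P..S. v s - e))\<^sup>2 \<le> (\<Sum>s=P..S. norm (v s - e))\<^sup>2"
    by (intro power_mono norm_sum) auto
  also have "\<dots> \<le> N * (\<Sum>s=P..S. (norm (v s - e))\<^sup>2)"
    using sum_squared_le_sum_of_squares[of "\<lambda>s. norm (v s - e)" "{P..S}"] N(2) by (simp add: mult.commute)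
  finally have "(1 / N)\<^sup>2 * (norm (\<Sum>s=P..S. v s - e))\<^sup>2 \<le> (1 / N)\<^sup>2 * (N * (\<Sum>s=P..S. (norm (v s - e))\<^sup>2))"
    by (intro mult_left_mono) auto
  also have "\<dots> = (1 / N) * (\<Sum>s=P..S. (norm (v s - e))\<^sup>2)"
    using N(1) by (simp add: power2_eq_square)
  finally show ?thesis
    unfolding N_def[symmetric] eq by (simp add: power_divide)
qed

section \<open>Decrease of the expected divergence and error of the averaged direction\<close>

context inner_loop
begin

text \<open>The expected second-order term of \<open>msmd_div_prox_map_le\<close>, after inserting
  \<open>norm_grad_phi_le\<close> and the bound m C^2 for the summed second moments.\<close>

definition noise_bound :: real where
  "noise_bound = C\<^sup>2 * (real CARD('m) * C\<^sup>2 + C\<^sup>2) + 8 * ln (real CARD('m)) * (C\<^sup>2 * (real CARD('m) * C\<^sup>2))"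

text \<open>The pair (e, p) stands for the saddle point of the subproblem. The last three conditions
  are what \<open>common_descent_saddle\<close> provides, with mean gradients as gradients.\<close>

context
  fixes e :: "real^'n" and p :: "real^'m"
  assumes e_norm: "norm e \<le> C" and p_mem: "p \<in> prob_simplex"
    and e_eq: "e = - (\<Sum>i\<in>UNIV. p $ i *\<^sub>R mean_grad i)"
    and saddle: "\<And>i. mean_grad i \<bullet> e \<le> - (norm e)\<^sup>2"
begin

lemma divergence_nonneg: "0 \<le> msmd_div C (z s \<omega>) (e, p)"
  unfolding msmd_div_def using kl_nonneg[OF p_mem z_mem(1,2)] card_ge_2 by auto

lemma divergence_measurable[measurable]: "(\<lambda>\<omega>. msmd_div C (z s \<omega>) (e, p)) \<in> borel_measurable M"
  unfolding msmd_div_def kl_def by measurable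

lemma distance_integrable: "integrable M (\<lambda>\<omega>. (norm (fst (z s \<omega>) - e))\<^sup>2)"
proof (rule integrable_const_bound[where B="(2 * C)\<^sup>2"])
  have "norm (fst (z s \<omega>) - e) \<le> 2 * C" for \<omega>
    using norm_triangle_ineq4[of "fst (z s \<omega>)" e] z_mem(3)[of s \<omega>] e_norm by linarith
  then have "(norm (fst (z s \<omega>) - e))\<^sup>2 \<le> (2 * C)\<^sup>2" for \<omega>
    by (intro power_mono) auto
  then show "AE \<omega> in M. norm ((norm (fst (z s \<omega>) - e))\<^sup>2) \<le> (2 * C)\<^sup>2"
    by simp
qed simp

text \<open>Averaging replaces each h i by its mean. Then e_eq evaluates the part weighted by p as
  -(e, d), and \<open>saddle\<close> bounds the part weighted by l, leaving (d, d - e) - (e, d) +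
  |e|^2 = |d - e|^2.\<close>

lemma expected_gap:
  shows "integrable M (\<lambda>\<omega>. grad_phi (\<lambda>i. h i (\<xi> s \<omega>)) (z s \<omega>) \<bullet> (z s \<omega> - (e, p)))"
    and "(\<integral>\<omega>. (norm (fst (z s \<omega>) - e))\<^sup>2 \<partial>M)
      \<le> (\<integral>\<omega>. grad_phi (\<lambda>i. h i (\<xi> s \<omega>)) (z s \<omega>) \<bullet> (z s \<omega> - (e, p)) \<partial>M)"
proof -
  \<comment> \<open>The vector paired with the i-th gradient in \<open>inner_grad_phi\<close>; its
    norm is at most 2 C because all weights lie in [0, 1].\<close>
  define u where "u i v = p $ i *\<^sub>R fst v - snd v $ i *\<^sub>R e" for i and v :: "(real^'n) \<times> (real^'m)"
  have u_meas: "u i \<in> borel_measurable borel" for i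
    unfolding u_def[abs_def] by (intro borel_measurable_continuous_onI continuous_intros)
  have u_bd: "norm (u i (z s \<omega>)) \<le> 2 * C" for i \<omega>
  proof -
    have "c * a \<le> C" if "0 \<le> c" "c \<le> 1" "0 \<le> a" "a \<le> C" for a c
      using mult_mono[of c 1 a C] that by simp
    then have "norm (p $ i *\<^sub>R fst (z s \<omega>)) \<le> C" "norm (snd (z s \<omega>) $ i *\<^sub>R e) \<le> C"
      using prob_simplexD(1,3)[OF p_mem] prob_simplexD(1,3)[OF z_mem(1)] z_mem(3) e_norm
      by simp_all
    then show ?thesis
      unfolding u_def using norm_triangle_ineq4[of "p $ i *\<^sub>R fst (z s \<omega>)" "snd (z s \<omega>) $ i *\<^sub>R e"] by linarith
  qed
  note E = expectation_inner[OF u_meas u_bd]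
  have q: "integrable M (\<lambda>\<omega>. fst (z s \<omega>) \<bullet> (fst (z s \<omega>) - e))"
  proof (rule integrable_const_bound[where B="C * (2 * C)"])
    have "\<bar>fst (z s \<omega>) \<bullet> (fst (z s \<omega>) - e)\<bar> \<le> C * (2 * C)" for \<omega>
    proof -
      have "\<bar>fst (z s \<omega>) \<bullet> (fst (z s \<omega>) - e)\<bar> \<le> norm (fst (z s \<omega>)) * norm (fst (z s \<omega>) - e)"
        by (rule Cauchy_Schwarz_ineq2)
      also have "\<dots> \<le> C * (2 * C)"
        using norm_triangle_ineq4[of "fst (z s \<omega>)" e] z_mem(3)[of s \<omega>] e_norm C_pos
        by (intro mult_mono) (linarith | simp)+
      finally show ?thesis .
    qed
    then show "AE \<omega> in M. norm (fst (z s \<omega>) \<bullet> (fst (z s \<omega>) - e)) \<le> C * (2 * C)"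
      by simp
  qed simp
  have gap: "grad_phi (\<lambda>i. h i (\<xi> s \<omega>)) (z s \<omega>) \<bullet> (z s \<omega> - (e, p))
      = fst (z s \<omega>) \<bullet> (fst (z s \<omega>) - e) + (\<Sum>i\<in>UNIV. h i (\<xi> s \<omega>) \<bullet> u i (z s \<omega>))" for \<omega>
    using inner_grad_phi[of _ "fst (z s \<omega>)" "snd (z s \<omega>)"] by (simp add: u_def)
  show "integrable M (\<lambda>\<omega>. grad_phi (\<lambda>i. h i (\<xi> s \<omega>)) (z s \<omega>) \<bullet> (z s \<omega> - (e, p)))"
    unfolding gap using q E(1) by auto
  have mean_gap: "(norm (fst (z s \<omega>) - e))\<^sup>2
      \<le> fst (z s \<omega>) \<bullet> (fst (z s \<omega>) - e) + (\<Sum>i\<in>UNIV. mean_grad i \<bullet> u i (z s \<omega>))" for \<omega>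
  proof -
    define d l where "d = fst (z s \<omega>)" and "l = snd (z s \<omega>)"
    have "(\<Sum>i\<in>UNIV. mean_grad i \<bullet> u i (z s \<omega>))
        = (\<Sum>i\<in>UNIV. p $ i *\<^sub>R mean_grad i) \<bullet> d - (\<Sum>i\<in>UNIV. l $ i * (mean_grad i \<bullet> e))"
      by (simp add: u_def d_def l_def inner_diff_right sum_subtractf inner_sum_left)
    also have "(\<Sum>i\<in>UNIV. p $ i *\<^sub>R mean_grad i) = - e"
      by (subst e_eq) simp
    finally have 1: "(\<Sum>i\<in>UNIV. mean_grad i \<bullet> u i (z s \<omega>)) = - (e \<bullet> d) - (\<Sum>i\<in>UNIV. l $ i * (mean_grad i \<bullet> e))"
      by simp
    have "(\<Sum>i\<in>UNIV. l $ i * (mean_grad i \<bullet> e)) \<le> - (norm e)\<^sup>2"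
      unfolding l_def by (rule prob_simplex_average_le[OF z_mem(1) saddle])
    then show ?thesis
      unfolding 1 d_def[symmetric]
      by (simp add: power2_norm_eq_inner inner_diff_left inner_diff_right inner_commute)
  qed
  have "(\<integral>\<omega>. (norm (fst (z s \<omega>) - e))\<^sup>2 \<partial>M)
      \<le> (\<integral>\<omega>. fst (z s \<omega>) \<bullet> (fst (z s \<omega>) - e) + (\<Sum>i\<in>UNIV. mean_grad i \<bullet> u i (z s \<omega>)) \<partial>M)"
    using distance_integrable q E(2) mean_gap by (intro integral_mono) auto
  also have "\<dots> = (\<integral>\<omega>. grad_phi (\<lambda>i. h i (\<xi> s \<omega>)) (z s \<omega>) \<bullet> (z s \<omega> - (e, p)) \<partial>M)"
    unfolding gap using q E by simp
  finally show "(\<integral>\<omega>. (norm (fst (z s \<omega>) - e))\<^sup>2 \<partial>M)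
      \<le> (\<integral>\<omega>. grad_phi (\<lambda>i. h i (\<xi> s \<omega>)) (z s \<omega>) \<bullet> (z s \<omega> - (e, p)) \<partial>M)" .
qed

text \<open>Integrability has to be propagated step by step, since the divergence is not uniformly
  bounded as weights become small.\<close>

lemma divergence_step:
  assumes int: "integrable M (\<lambda>\<omega>. msmd_div C (z s \<omega>) (e, p))"
  shows "integrable M (\<lambda>\<omega>. msmd_div C (z (Suc s) \<omega>) (e, p))"
    and "(\<integral>\<omega>. msmd_div C (z (Suc s) \<omega>) (e, p) \<partial>M) \<le> (\<integral>\<omega>. msmd_div C (z s \<omega>) (e, p) \<partial>M)
      - \<gamma> * (\<integral>\<omega>. (norm (fst (z s \<omega>) - e))\<^sup>2 \<partial>M) + \<gamma>\<^sup>2 * noise_bound"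
proof -
  define T where "T \<omega> = (\<Sum>i\<in>UNIV. (norm (h i (\<xi> s \<omega>)))\<^sup>2)" for \<omega>
  define \<Gamma> where "\<Gamma> \<omega> = grad_phi (\<lambda>i. h i (\<xi> s \<omega>)) (z s \<omega>) \<bullet> (z s \<omega> - (e, p))" for \<omega>
  define R where "R \<omega> = C\<^sup>2 * (T \<omega> + C\<^sup>2) + 8 * ln (real CARD('m)) * (C\<^sup>2 * T \<omega>)" for \<omega>
  have T: "integrable M T" "(\<integral>\<omega>. T \<omega> \<partial>M) \<le> real CARD('m) * C\<^sup>2"
  proof -
    show "integrable M T"
      unfolding T_def[abs_def] using sq_integrable(1) by auto
    have "(\<integral>\<omega>. T \<omega> \<partial>M) = (\<Sum>i\<in>UNIV. \<integral>\<omega>. (norm (h i (\<xi> s \<omega>)))\<^sup>2 \<partial>M)"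
      unfolding T_def using sq_integrable(1) by simp
    also have "\<dots> \<le> (\<Sum>i\<in>(UNIV::'m set). C\<^sup>2)"
      by (intro sum_mono sq_integrable(2))
    finally show "(\<integral>\<omega>. T \<omega> \<partial>M) \<le> real CARD('m) * C\<^sup>2" by simp
  qed
  have lnm: "0 \<le> ln (real CARD('m))"
    using card_ge_2 by simp
  have R: "integrable M R" "(\<integral>\<omega>. R \<omega> \<partial>M) \<le> noise_bound"
  proof -
    show "integrable M R"
      unfolding R_def[abs_def] using T(1) by auto
    have "(\<integral>\<omega>. R \<omega> \<partial>M) = C\<^sup>2 * ((\<integral>\<omega>. T \<omega> \<partial>M) + C\<^sup>2)
        + 8 * ln (real CARD('m)) * (C\<^sup>2 * (\<integral>\<omega>. T \<omega> \<partial>M))"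
      unfolding R_def using T(1) by (simp add: prob_space)
    also have "\<dots> \<le> noise_bound"
      unfolding noise_bound_def using T(2) lnm
      by (intro add_mono mult_left_mono) auto
    finally show "(\<integral>\<omega>. R \<omega> \<partial>M) \<le> noise_bound" .
  qed
  have \<Gamma>: "integrable M \<Gamma>" "(\<integral>\<omega>. (norm (fst (z s \<omega>) - e))\<^sup>2 \<partial>M) \<le> (\<integral>\<omega>. \<Gamma> \<omega> \<partial>M)"
    using expected_gap[of s] by (auto simp: \<Gamma>_def[abs_def])
  have step: "msmd_div C (z (Suc s) \<omega>) (e, p) \<le> msmd_div C (z s \<omega>) (e, p) - \<gamma> * \<Gamma> \<omega> + \<gamma>\<^sup>2 * R \<omega>" for \<omega>
  proof -
    define d l where "d = fst (z s \<omega>)" and "l = snd (z s \<omega>)"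
    define a b where "a = fst (grad_phi (\<lambda>i. h i (\<xi> s \<omega>)) (d, l))" and "b = snd (grad_phi (\<lambda>i. h i (\<xi> s \<omega>)) (d, l))"
    have zdl: "z s \<omega> = (d, l)"
      by (simp add: d_def l_def)
    have l: "l \<in> prob_simplex" "0 < l $ i" for i
      using z_mem by (auto simp: l_def)
    have "msmd_div C (z (Suc s) \<omega>) (e, p) \<le> msmd_div C (d, l) (e, p) - \<gamma> * ((a, b) \<bullet> ((d, l) - (e, p)))
      + \<gamma>\<^sup>2 * (C\<^sup>2 / 2 * (norm a)\<^sup>2 + 8 * ln (real CARD('m)) * (norm b)\<^sup>2)"
      unfolding z_Suc zdl fst_conv snd_conv a_def[symmetric] b_def[symmetric]
      by (rule msmd_div_prox_map_le[OF card_ge_2 C_pos l e_norm p_mem])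
    also have "(a, b) \<bullet> ((d, l) - (e, p)) = \<Gamma> \<omega>"
      by (simp add: a_def b_def \<Gamma>_def zdl)
    finally have 1: "msmd_div C (z (Suc s) \<omega>) (e, p) \<le> msmd_div C (z s \<omega>) (e, p) - \<gamma> * \<Gamma> \<omega>
      + \<gamma>\<^sup>2 * (C\<^sup>2 / 2 * (norm a)\<^sup>2 + 8 * ln (real CARD('m)) * (norm b)\<^sup>2)"
      by (simp add: zdl)
    have d: "norm d \<le> C"
      using z_mem by (simp add: d_def)
    have "C\<^sup>2 / 2 * (norm a)\<^sup>2 + 8 * ln (real CARD('m)) * (norm b)\<^sup>2
      \<le> C\<^sup>2 / 2 * (2 * T \<omega> + 2 * C\<^sup>2) + 8 * ln (real CARD('m)) * (C\<^sup>2 * T \<omega>)"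
      unfolding a_def b_def T_def using norm_grad_phi_le[OF l(1) d] lnm
      by (intro add_mono mult_left_mono) auto
    also have "\<dots> = R \<omega>"
      by (simp add: R_def algebra_simps)
    finally show ?thesis
      using 1 mult_left_mono[of _ "R \<omega>" "\<gamma>\<^sup>2"] by (smt (verit) zero_le_power2)
  qed
  have rhs: "integrable M (\<lambda>\<omega>. msmd_div C (z s \<omega>) (e, p) - \<gamma> * \<Gamma> \<omega> + \<gamma>\<^sup>2 * R \<omega>)"
    using int \<Gamma>(1) R(1) by auto
  \<comment> \<open>The new divergence lies between 0 and the integrable right side of
    \<open>step\<close>.\<close>
  show int': "integrable M (\<lambda>\<omega>. msmd_div C (z (Suc s) \<omega>) (e, p))"
  proof (rule Bochner_Integration.integrable_bound[OF rhs])
    show "AE \<omega> in M. norm (msmd_div C (z (Suc s) \<omega>) (e, p))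
      \<le> norm (msmd_div C (z s \<omega>) (e, p) - \<gamma> * \<Gamma> \<omega> + \<gamma>\<^sup>2 * R \<omega>)"
      using step divergence_nonneg[of "Suc s"] by (intro AE_I2) (smt (verit) real_norm_def)
  qed simp
  have "(\<integral>\<omega>. msmd_div C (z (Suc s) \<omega>) (e, p) \<partial>M)
      \<le> (\<integral>\<omega>. msmd_div C (z s \<omega>) (e, p) - \<gamma> * \<Gamma> \<omega> + \<gamma>\<^sup>2 * R \<omega> \<partial>M)"
    using int' rhs step by (intro integral_mono) auto
  also have "\<dots> = (\<integral>\<omega>. msmd_div C (z s \<omega>) (e, p) \<partial>M) - \<gamma> * (\<integral>\<omega>. \<Gamma> \<omega> \<partial>M) + \<gamma>\<^sup>2 * (\<integral>\<omega>. R \<omega> \<partial>M)"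
    using int \<Gamma>(1) R(1) by simp
  also have "\<dots> \<le> (\<integral>\<omega>. msmd_div C (z s \<omega>) (e, p) \<partial>M)
      - \<gamma> * (\<integral>\<omega>. (norm (fst (z s \<omega>) - e))\<^sup>2 \<partial>M) + \<gamma>\<^sup>2 * noise_bound"
    using \<Gamma>(2) R(2) \<gamma>_pos by (intro add_mono diff_mono mult_left_mono) auto
  finally show "(\<integral>\<omega>. msmd_div C (z (Suc s) \<omega>) (e, p) \<partial>M) \<le> (\<integral>\<omega>. msmd_div C (z s \<omega>) (e, p) \<partial>M)
      - \<gamma> * (\<integral>\<omega>. (norm (fst (z s \<omega>) - e))\<^sup>2 \<partial>M) + \<gamma>\<^sup>2 * noise_bound" .
qed

text \<open>The scaling of \<open>omega_z\<close> makes each part at most 1/2: |e| \<le> C against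
  the start d = 0, and relative entropy at most ln m against uniform weights.\<close>

lemma initial_divergence_le: "msmd_div C (z 0 \<omega>) (e, p) \<le> 1"
proof -
  have "(norm e)\<^sup>2 \<le> C\<^sup>2"
    using e_norm by (intro power_mono) auto
  then have "(norm e)\<^sup>2 / (2 * C\<^sup>2) \<le> 1 / 2"
    using C_pos by (simp add: field_simps)
  moreover have "kl p (\<chi> i. 1 / real CARD('m)) / (2 * ln (real CARD('m))) \<le> 1 / 2"
    using kl_uniform_le[OF p_mem] card_ge_2 by (simp add: field_simps)
  ultimately show ?thesis
    by (simp add: z_def msmd_div_def)
qed

lemma sum_distance_le:
  "\<gamma> * (\<Sum>s<N. \<integral>\<omega>. (norm (fst (z s \<omega>) - e))\<^sup>2 \<partial>M) \<le> 1 + real N * \<gamma>\<^sup>2 * noise_bound"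
proof -
  define v where "v s = (\<integral>\<omega>. msmd_div C (z s \<omega>) (e, p) \<partial>M)" for s
  define q where "q s = (\<integral>\<omega>. (norm (fst (z s \<omega>) - e))\<^sup>2 \<partial>M)" for s
  have int: "integrable M (\<lambda>\<omega>. msmd_div C (z s \<omega>) (e, p))" for s
    by (induction s) (auto simp: divergence_step(1), simp add: z_def)
  have v0: "v 0 \<le> 1"
    unfolding v_def using int initial_divergence_le
    by (intro integral_le_const) auto
  have "\<gamma> * (\<Sum>s<N. q s) \<le> v 0 - v N + real N * \<gamma>\<^sup>2 * noise_bound"
  proof (induction N)
    case (Suc N)
    then show ?case
      using divergence_step(2)[OF int[of N]] unfolding v_def[symmetric] q_def[symmetric]
      by (simp add: algebra_simps)
  qed simp
  moreover have "0 \<le> v N"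
    unfolding v_def by (intro Bochner_Integration.integral_nonneg divergence_nonneg)
  ultimately show ?thesis
    using v0 by (simp add: q_def)
qed

lemma average_distance_le:
  assumes "P \<le> S"
  shows "(\<integral>\<omega>. (norm (fst (weighted_avg (\<lambda>_. \<gamma>) (\<lambda>s. z s \<omega>) P S) - e))\<^sup>2 \<partial>M)
    \<le> (1 + real (S + 1) * \<gamma>\<^sup>2 * noise_bound) / (\<gamma> * real (S - P + 1))"
proof -
  define N where "N = real (S - P + 1)"
  have N: "0 < N" by (simp add: N_def)
  have "(\<integral>\<omega>. (norm (fst (weighted_avg (\<lambda>_. \<gamma>) (\<lambda>s. z s \<omega>) P S) - e))\<^sup>2 \<partial>M)
    \<le> (\<integral>\<omega>. (1 / N) * (\<Sum>s=P..S. (norm (fst (z s \<omega>) - e))\<^sup>2) \<partial>M)"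
    unfolding fst_weighted_avg_const[OF \<gamma>_pos assms] N_def
    using distance_integrable norm_average_diff_le[OF assms]
    by (intro integral_mono_AE' AE_I2) (auto intro!: sum_nonneg divide_nonneg_nonneg)
  also have "\<dots> = (1 / N) * (\<Sum>s=P..S. \<integral>\<omega>. (norm (fst (z s \<omega>) - e))\<^sup>2 \<partial>M)"
    using distance_integrable by simp
  \<comment> \<open>The sum includes index S, so its bound uses a virtual step from z_S to z_(S+1)
    that the method does not perform; the average itself uses only samples before S.\<close>
  also have "\<dots> \<le> (1 / N) * (\<Sum>s<S + 1. \<integral>\<omega>. (norm (fst (z s \<omega>) - e))\<^sup>2 \<partial>M)"
    using N by (intro mult_left_mono sum_mono2) auto
  also have "\<dots> \<le> (1 / N) * ((1 + real (S + 1) * \<gamma>\<^sup>2 * noise_bound) / \<gamma>)"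
    using sum_distance_le[of "S + 1"] N \<gamma>_pos
    by (intro mult_left_mono) (simp_all add: pos_le_divide_eq mult.commute)
  finally show ?thesis
    by (simp add: N_def mult.commute)
qed

end

end

subsection \<open>The outer loop\<close>

text \<open>The outer point and the samples are separate arguments, so that the point can be frozen
  while the samples are averaged.\<close>

definition msmd_direction ::
  "('m::finite \<Rightarrow> real^'n \<Rightarrow> 'x \<Rightarrow> real^'n) \<Rightarrow> real \<Rightarrow> real \<Rightarrow> nat \<Rightarrow> nat \<Rightarrow> real^'n \<Rightarrow> (nat \<Rightarrow> 'x) \<Rightarrow> real^'n" where
  "msmd_direction G C \<gamma> P S x y =
     fst (weighted_avg (\<lambda>_. \<gamma>) (msmd_inner C (\<lambda>_. \<gamma>) (\<lambda>s i. G i x (y s))) P S)"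

lemma norm_msmd_direction_le:
  fixes G :: "'m::finite \<Rightarrow> real^'n \<Rightarrow> 'x \<Rightarrow> real^'n"
  assumes "CARD('m) \<ge> 2" "0 < C" "0 < \<gamma>" "P \<le> S"
  shows "norm (msmd_direction G C \<gamma> P S x y) \<le> C"
proof -
  define v where "v s = fst (msmd_inner C (\<lambda>_. \<gamma>) (\<lambda>s i. G i x (y s)) s)" for s
  define N where "N = real (S - P + 1)"
  have N: "0 < N" "real (card {P..S}) = N"
    using assms by (auto simp: N_def Suc_diff_le)
  have "norm (\<Sum>s=P..S. v s) \<le> real (card {P..S}) * C"
    unfolding v_def using msmd_inner_mem[OF assms(1,2)] by (intro sum_norm_bound) blast
  then show ?thesis
    unfolding msmd_direction_def fst_weighted_avg_const[OF assms(3,4)] N_def[symmetric] v_def[symmetric]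
    using N by (simp add: field_simps)
qed

lemma msmd_direction_measurable:
  fixes G :: "'m::finite \<Rightarrow> real^'n \<Rightarrow> 'x \<Rightarrow> real^'n"
  assumes "CARD('m) \<ge> 2" "0 < C" "0 < \<gamma>" "P \<le> S"
    and G: "\<And>i. (\<lambda>(x, y). G i x y) \<in> borel_measurable (borel \<Otimes>\<^sub>M Q)"
    and X[measurable]: "X \<in> borel_measurable N" and Y: "\<And>s. (\<lambda>\<omega>. Y \<omega> s) \<in> measurable N Q"
  shows "(\<lambda>\<omega>. msmd_direction G C \<gamma> P S (X \<omega>) (Y \<omega>)) \<in> borel_measurable N"
proof -
  note [measurable] = Y
  have "(\<lambda>\<omega>. G i (X \<omega>) (Y \<omega> t)) \<in> borel_measurable N" for i t
    using measurable_compose[of "\<lambda>\<omega>. (X \<omega>, Y \<omega> t)" N "borel \<Otimes>\<^sub>M Q", OF _ G[of i]] by simp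
  then have "(\<lambda>\<omega>. fst (msmd_inner C (\<lambda>_. \<gamma>) (\<lambda>s i. G i (X \<omega>) (Y \<omega> s)) s)) \<in> borel_measurable N" for s
    by (intro borel_measurable_fst_snd msmd_inner_measurable assms)
  then show ?thesis
    unfolding msmd_direction_def fst_weighted_avg_const[OF assms(3,4)] by simp
qed

section \<open>One outer step from a fixed point and its constants\<close>

locale msmd_method = prob_space M
  for M :: "'w measure" +
  fixes f :: "'m::finite \<Rightarrow> real^'n \<Rightarrow> real"
    and G :: "'m \<Rightarrow> real^'n \<Rightarrow> 'x \<Rightarrow> real^'n"
    and Q :: "'x measure"
    and \<xi> :: "nat \<Rightarrow> nat \<Rightarrow> 'w \<Rightarrow> 'x"
    and x\<^sub>0 :: "real^'n"
    and L F_inf C \<delta> \<theta> \<alpha> r :: real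
  assumes card_ge_2: "CARD('m) \<ge> 2"
    and diff: "\<And>i x. f i differentiable (at x)"
    and lip: "\<And>i. L-lipschitz_on UNIV (grad (f i))"
    and G_measurable: "\<And>i. (\<lambda>(x, y). G i x y) \<in> borel_measurable (borel \<Otimes>\<^sub>M Q)"
    and indep: "indep_vars (\<lambda>_. Q) (\<lambda>(k, s). \<xi> k s) UNIV"
    and law: "\<And>k s. distr M Q (\<xi> k s) = Q"
    and L_pos: "0 < L" and C_pos: "0 < C" and \<theta>_pos: "0 < \<theta>"
    and r_pos: "0 < r" and r_less: "r < 1"
    and \<alpha>_pos: "0 < \<alpha>" and \<alpha>_le: "\<alpha> \<le> 1 / (4 * L)"
begin

lemma \<xi>_measurable[measurable]: "\<xi> k s \<in> measurable M Q"
  using indep unfolding indep_vars_def by (auto dest!: spec[of _ "(k, s)"] bspec[of _ _ "(k, s)"])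

lemma indep_inner: "indep_vars (\<lambda>_. Q) (\<xi> k) UNIV"
proof -
  have "indep_vars (\<lambda>s. PiM {(k, s)} (\<lambda>_. Q)) (\<lambda>s \<omega>. restrict (\<lambda>i. (case i of (k, s) \<Rightarrow> \<xi> k s) \<omega>) {(k, s)}) UNIV"
    by (rule indep_vars_restrict[OF indep]) (auto simp: disjoint_family_on_def)
  then have "indep_vars (\<lambda>_. Q) (\<lambda>s \<omega>. (\<lambda>y. y (k, s)) (restrict (\<lambda>i. (case i of (k, s) \<Rightarrow> \<xi> k s) \<omega>) {(k, s)})) UNIV"
    by (rule indep_vars_compose2) simp
  then show ?thesis by simp
qed

text \<open>Supplies integrability of the objectives at the iterates: directions have norm at most
  C, so finitely many steps stay in a compact ball, where continuity bounds f.\<close>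

lemma f_bounded_near:
  obtains B where "\<And>y. norm (y - x) \<le> R \<Longrightarrow> \<bar>f i y\<bar> \<le> B"
proof -
  have "compact (f i ` cball x R)"
    using diff by (intro compact_continuous_image continuous_on_if_differentiable) auto
  then obtain B where "\<forall>v\<in>f i ` cball x R. norm v \<le> B"
    using compact_imp_bounded bounded_iff by metis
  then show thesis
    by (intro that[of B]) (auto simp: dist_norm norm_minus_commute)
qed

lemma f_measurable: "f i \<in> borel_measurable borel"
  using diff by (intro borel_measurable_continuous_onI continuous_on_if_differentiable)

text \<open>The inner loop controls the squared error, but the descent is affected linearly. The
  parameter t balances the two through 2 \<epsilon> \<le> \<epsilon>^2 / t + t: an expected square
  at most t^2 costs at most 2 t.\<close>

lemma expected_descent:
  assumes at_x: "oracle_at Q f G C \<delta> x" and \<gamma>: "0 < \<gamma>" and P: "P \<le> S" and t: "0 < t"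
    and bound: "(1 + real (S + 1) * \<gamma>\<^sup>2 * (C\<^sup>2 * (real CARD('m) * C\<^sup>2 + C\<^sup>2)
      + 8 * ln (real CARD('m)) * (C\<^sup>2 * (real CARD('m) * C\<^sup>2)))) / (\<gamma> * real (S - P + 1)) \<le> t\<^sup>2"
  shows "(\<integral>\<omega>. f i (x + \<alpha> *\<^sub>R msmd_direction G C \<gamma> P S x (\<lambda>s. \<xi> k s \<omega>)) \<partial>M)
    \<le> f i x - \<alpha> / 2 * (norm (common_descent f x))\<^sup>2 + 2 * \<alpha> * C * t"
proof -
  define e where "e = common_descent f x"
  define d where "d \<omega> = msmd_direction G C \<gamma> P S x (\<lambda>s. \<xi> k s \<omega>)" for \<omega>
  have h_meas: "G i x \<in> borel_measurable Q" for i
    using measurable_compose[OF measurable_Pair1' G_measurable[of i], of x] by simp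
  interpret I: inner_loop M Q "\<xi> k" "\<lambda>i. G i x" C \<gamma>
    using at_x card_ge_2 C_pos \<gamma> indep_inner law h_meas
    by unfold_locales (auto simp: oracle_at_def)
  have mean: "I.mean_grad i = grad (f i) x" for i
    using at_x by (auto simp: oracle_at_def I.mean_grad_def has_bochner_integral_integral_eq)
  obtain p where p: "p \<in> prob_simplex" "e = - (\<Sum>i\<in>UNIV. p $ i *\<^sub>R grad (f i) x)"
    "\<And>i. grad (f i) x \<bullet> e \<le> - (norm e)\<^sup>2"
    using common_descent_saddle[of f x] unfolding e_def by blast
  have g_le: "norm (grad (f i) x) \<le> C" for i
    using I.norm_mean_grad_le[of i] by (simp add: mean)
  have e_le: "norm e \<le> C"
  proof -
    have "norm (\<Sum>i\<in>UNIV. p $ i *\<^sub>R grad (f i) x) \<le> (\<Sum>i\<in>UNIV. norm (p $ i *\<^sub>R grad (f i) x))"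
      by (rule norm_sum)
    also have "\<dots> = (\<Sum>i\<in>UNIV. p $ i * norm (grad (f i) x))"
      using prob_simplexD(1)[OF p(1)] by simp
    also have "\<dots> \<le> C"
      by (rule prob_simplex_average_le[OF p(1) g_le])
    finally show ?thesis by (simp add: p(2))
  qed
  have d_le: "norm (d \<omega>) \<le> C" for \<omega>
    unfolding d_def by (rule norm_msmd_direction_le[OF card_ge_2 C_pos \<gamma> P])
  have d_meas[measurable]: "d \<in> borel_measurable M"
    unfolding d_def[abs_def]
    by (rule msmd_direction_measurable[OF card_ge_2 C_pos \<gamma> P G_measurable]) simp_all
  have err: "(\<integral>\<omega>. (norm (d \<omega> - e))\<^sup>2 \<partial>M) \<le> t\<^sup>2"
    using I.average_distance_le[OF e_le p(1) _ _ P] bound p(2,3)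
    unfolding I.noise_bound_def mean d_def msmd_direction_def I.z_def by force
  have err_le: "norm (d \<omega> - e) \<le> 2 * C" for \<omega>
    using norm_triangle_ineq4[of "d \<omega>" e] d_le[of \<omega>] e_le by linarith
  \<comment> \<open>Since the error is at most 2 C, its square is absorbed by the linear term, and
    both losses combine into one multiple of \<epsilon>.\<close>
  have sq_le: "(norm (d \<omega> - e))\<^sup>2 \<le> 2 * C * norm (d \<omega> - e)" for \<omega>
    using err_le[of \<omega>] by (simp add: power2_eq_square mult_right_mono)
  have err_int: "integrable M (\<lambda>\<omega>. (norm (d \<omega> - e))\<^sup>2)"
  proof (rule integrable_const_bound[where B="(2 * C)\<^sup>2"])
    have "(norm (d \<omega> - e))\<^sup>2 \<le> (2 * C)\<^sup>2" for \<omega>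
      by (rule power_mono[OF err_le]) simp
    then show "AE \<omega> in M. norm ((norm (d \<omega> - e))\<^sup>2) \<le> (2 * C)\<^sup>2"
      by simp
  qed simp
  have pointwise: "f i (x + \<alpha> *\<^sub>R d \<omega>)
      \<le> f i x - \<alpha> / 2 * (norm e)\<^sup>2 + \<alpha> * C * ((norm (d \<omega> - e))\<^sup>2 / t + t)" for \<omega>
  proof -
    define \<epsilon> where "\<epsilon> = norm (d \<omega> - e)"
    have "f i (x + \<alpha> *\<^sub>R d \<omega>) \<le> f i x + grad (f i) x \<bullet> (\<alpha> *\<^sub>R d \<omega>) + L * (norm (\<alpha> *\<^sub>R d \<omega>))\<^sup>2"
      by (rule lipschitz_grad_upper_bound[OF diff lip])
    also have "\<dots> = f i x + \<alpha> * (grad (f i) x \<bullet> d \<omega>) + (L * \<alpha>) * \<alpha> * (norm (d \<omega>))\<^sup>2"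
      by (simp add: power_mult_distrib power2_eq_square)
    \<comment> \<open>The step size bound L \<alpha> \<le> 1/4 lets the quadratic term take back
      only half of the first-order decrease.\<close>
    also have "\<dots> \<le> f i x + \<alpha> * (- (norm e)\<^sup>2 + C * \<epsilon>) + (1 / 4) * \<alpha> * (2 * (norm e)\<^sup>2 + 2 * \<epsilon>\<^sup>2)"
    proof (intro add_mono mult_left_mono mult_mono)
      have "grad (f i) x \<bullet> (d \<omega> - e) \<le> norm (grad (f i) x) * \<epsilon>"
        unfolding \<epsilon>_def by (rule norm_cauchy_schwarz)
      also have "\<dots> \<le> C * \<epsilon>"
        using g_le by (intro mult_right_mono) (auto simp: \<epsilon>_def)
      finally show "grad (f i) x \<bullet> d \<omega> \<le> - (norm e)\<^sup>2 + C * \<epsilon>"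
        using p(3)[of i] by (simp add: inner_diff_right)
      have "norm (d \<omega>) \<le> norm e + \<epsilon>"
        unfolding \<epsilon>_def using norm_triangle_ineq[of e "d \<omega> - e"] by simp
      then have "(norm (d \<omega>))\<^sup>2 \<le> (norm e + \<epsilon>)\<^sup>2"
        by (intro power_mono) auto
      also have "\<dots> \<le> 2 * (norm e)\<^sup>2 + 2 * \<epsilon>\<^sup>2"
        using zero_le_power2[of "norm e - \<epsilon>"] by (simp add: power2_sum power2_diff)
      finally show "(norm (d \<omega>))\<^sup>2 \<le> 2 * (norm e)\<^sup>2 + 2 * \<epsilon>\<^sup>2" .
      show "L * \<alpha> \<le> 1 / 4"
        using \<alpha>_le L_pos by (simp add: field_simps)
    qed (use \<alpha>_pos in auto)
    also have "\<dots> = f i x - \<alpha> / 2 * (norm e)\<^sup>2 + \<alpha> * C * \<epsilon> + \<alpha> / 2 * \<epsilon>\<^sup>2"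
      by (simp add: algebra_simps)
    also have "\<dots> \<le> f i x - \<alpha> / 2 * (norm e)\<^sup>2 + \<alpha> * C * \<epsilon> + \<alpha> / 2 * (2 * C * \<epsilon>)"
      using sq_le[of \<omega>] \<alpha>_pos by (intro add_left_mono mult_left_mono) (auto simp: \<epsilon>_def)
    also have "\<dots> = f i x - \<alpha> / 2 * (norm e)\<^sup>2 + \<alpha> * C * (2 * \<epsilon>)"
      by (simp add: algebra_simps)
    also have "\<dots> \<le> f i x - \<alpha> / 2 * (norm e)\<^sup>2 + \<alpha> * C * (\<epsilon>\<^sup>2 / t + t)"
    proof (intro add_left_mono mult_left_mono)
      show "2 * \<epsilon> \<le> \<epsilon>\<^sup>2 / t + t"
        using t zero_le_power2[of "\<epsilon> - t"] by (simp add: power2_diff field_simps power2_eq_square)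
    qed (use \<alpha>_pos C_pos in auto)
    finally show ?thesis by (simp add: \<epsilon>_def)
  qed
  obtain B where B: "\<And>y. norm (y - x) \<le> \<alpha> * C \<Longrightarrow> \<bar>f i y\<bar> \<le> B"
    using f_bounded_near[of x "\<alpha> * C" i] by blast
  have f_int: "integrable M (\<lambda>\<omega>. f i (x + \<alpha> *\<^sub>R d \<omega>))"
  proof (rule integrable_const_bound[where B=B])
    show "AE \<omega> in M. norm (f i (x + \<alpha> *\<^sub>R d \<omega>)) \<le> B"
      using B d_le \<alpha>_pos by simp
    show "(\<lambda>\<omega>. f i (x + \<alpha> *\<^sub>R d \<omega>)) \<in> borel_measurable M"
      by (rule measurable_compose[OF _ f_measurable]) simp
  qed
  have "(\<integral>\<omega>. f i (x + \<alpha> *\<^sub>R d \<omega>) \<partial>M)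
      \<le> (\<integral>\<omega>. f i x - \<alpha> / 2 * (norm e)\<^sup>2 + \<alpha> * C * ((norm (d \<omega> - e))\<^sup>2 / t + t) \<partial>M)"
    using f_int err_int pointwise by (intro integral_mono) auto
  also have "\<dots> = f i x - \<alpha> / 2 * (norm e)\<^sup>2 + \<alpha> * C * ((\<integral>\<omega>. (norm (d \<omega> - e))\<^sup>2 \<partial>M) / t + t)"
    using err_int by (simp add: prob_space)
  also have "\<dots> \<le> f i x - \<alpha> / 2 * (norm e)\<^sup>2 + \<alpha> * C * (t\<^sup>2 / t + t)"
    using err t \<alpha>_pos C_pos by (intro add_left_mono mult_left_mono add_right_mono divide_right_mono) auto
  also have "\<dots> = f i x - \<alpha> / 2 * (norm e)\<^sup>2 + 2 * \<alpha> * C * t"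
    using t by (simp add: power2_eq_square)
  finally show ?thesis
    by (simp add: d_def e_def)
qed

text \<open>Chosen so that S = n^2 inner steps give a squared error of at most
  \<open>rate_const\<close> / n. The final bracket is the expression of \<open>noise_bound\<close>;
  nothing depends on S or K.\<close>

definition rate_const :: real where
  "rate_const = (let \<mu> = M_star CARD('m) C \<delta> in
    \<mu> / (\<theta> * (1 - r)) * (1 + 2 * \<theta>\<^sup>2 / \<mu>\<^sup>2 * (C\<^sup>2 * (real CARD('m) * C\<^sup>2 + C\<^sup>2)
      + 8 * ln (real CARD('m)) * (C\<^sup>2 * (real CARD('m) * C\<^sup>2)))))"

lemma M_star_pos: "0 < M_star CARD('m) C \<delta>"
proof -
  have "0 < ln (real CARD('m))"
    using card_ge_2 by simp
  then have "0 < (2 + ln (real CARD('m))) * (real CARD('m))\<^sup>2 * C ^ 4"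
    using C_pos card_ge_2 by (intro mult_pos_pos add_pos_pos zero_less_power) auto
  moreover have "0 \<le> (1/2 + ln (real CARD('m))) * (real CARD('m))\<^sup>2 * C\<^sup>2 * \<delta>\<^sup>2"
    using card_ge_2 by simp
  ultimately show ?thesis
    unfolding M_star_def by (intro real_sqrt_gt_zero add_pos_nonneg)
qed

lemma rate_const_pos: "0 < rate_const"
  unfolding rate_const_def Let_def using M_star_pos \<theta>_pos r_less C_pos card_ge_2
  by (intro mult_pos_pos divide_pos_pos add_pos_nonneg) auto

text \<open>The number of averaged iterates is S - P + 1; its summand 1 compensates for the rounding
  in P \<le> r S + 1.\<close>

lemma ceiling_bounds:
  assumes "1 \<le> S"
  shows "nat \<lceil>r * real S\<rceil> \<le> S" "(1 - r) * real S \<le> real (S - nat \<lceil>r * real S\<rceil> + 1)"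
proof -
  have "r * real S \<le> 1 * real S"
    using r_less by (intro mult_right_mono) auto
  then have le: "\<lceil>r * real S\<rceil> \<le> int S"
    by (intro ceiling_le) simp
  then show 1: "nat \<lceil>r * real S\<rceil> \<le> S"
    by (simp only: nat_le_iff)
  have "0 \<le> \<lceil>r * real S\<rceil>"
    using r_pos by (simp add: order_less_le_trans[of "-1" 0])
  then have "real (nat \<lceil>r * real S\<rceil>) \<le> r * real S + 1"
    by linarith
  then show "(1 - r) * real S \<le> real (S - nat \<lceil>r * real S\<rceil> + 1)"
    using 1 by (simp add: of_nat_diff algebra_simps)
qed

text \<open>With this step size \<gamma>^2 S is constant and \<gamma> S is proportional to n. The
  factor 2 comes from S + 1 \<le> 2 S.\<close>

lemma inner_error_bound:
  assumes n: "1 \<le> (n::nat)" and S: "S = n\<^sup>2" and \<gamma>: "\<gamma> = \<theta> / (M_star CARD('m) C \<delta> * sqrt (real S))"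
    and \<rho>: "0 \<le> \<rho>"
  shows "(1 + real (S + 1) * \<gamma>\<^sup>2 * \<rho>) / (\<gamma> * real (S - nat \<lceil>r * real S\<rceil> + 1))
    \<le> M_star CARD('m) C \<delta> / (\<theta> * (1 - r)) * (1 + 2 * \<theta>\<^sup>2 / (M_star CARD('m) C \<delta>)\<^sup>2 * \<rho>) / real n"
proof -
  define \<mu> where "\<mu> = M_star CARD('m) C \<delta>"
  have \<mu>: "0 < \<mu>" unfolding \<mu>_def by (rule M_star_pos)
  have S1: "1 \<le> S" using n S by simp
  have sq: "sqrt (real S) = real n" by (simp add: S)
  have g: "\<gamma> = \<theta> / (\<mu> * real n)" unfolding \<gamma> sq \<mu>_def ..
  have g_pos: "0 < \<gamma>" unfolding g using \<theta>_pos \<mu> n by simp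
  have "real (S + 1) * \<gamma>\<^sup>2 \<le> (2 * real S) * \<gamma>\<^sup>2"
    using S1 by (intro mult_right_mono) auto
  also have "\<dots> = 2 * \<theta>\<^sup>2 / \<mu>\<^sup>2"
    unfolding g S using n by (simp add: power_divide power_mult_distrib)
  finally have 1: "1 + real (S + 1) * \<gamma>\<^sup>2 * \<rho> \<le> 1 + 2 * \<theta>\<^sup>2 / \<mu>\<^sup>2 * \<rho>"
    using \<rho> by (intro add_left_mono mult_right_mono) auto
  have "\<gamma> * ((1 - r) * real S) \<le> \<gamma> * real (S - nat \<lceil>r * real S\<rceil> + 1)"
    using ceiling_bounds(2)[OF S1] g_pos by (intro mult_left_mono) auto
  then have "(1 + real (S + 1) * \<gamma>\<^sup>2 * \<rho>) / (\<gamma> * real (S - nat \<lceil>r * real S\<rceil> + 1))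
    \<le> (1 + 2 * \<theta>\<^sup>2 / \<mu>\<^sup>2 * \<rho>) / (\<gamma> * ((1 - r) * real S))"
    using 1 \<rho> g_pos r_less S1 by (intro frac_le) auto
  also have "\<gamma> * ((1 - r) * real S) = \<theta> * (1 - r) / \<mu> * real n"
    unfolding g S using n by (simp add: power2_eq_square)
  finally show ?thesis
    unfolding \<mu>_def[symmetric] by (simp add: mult_ac)
qed

end

section \<open>Random outer iterates, telescoping and the final constants\<close>

lemma msmd_cong:
  assumes "\<And>j. j < k \<Longrightarrow> y j = y' j"
  shows "msmd G C r S \<gamma> \<alpha> x\<^sub>0 y k = msmd G C r S \<gamma> \<alpha> x\<^sub>0 y' k"
  using assms by (induction k) (auto simp: Let_def)

lemma msmd_Suc_direction:
  "msmd G C r S (\<lambda>j s. \<gamma> j) (\<lambda>j. \<alpha>) x\<^sub>0 y (Suc k) = msmd G C r S (\<lambda>j s. \<gamma> j) (\<lambda>j. \<alpha>) x\<^sub>0 y k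
    + \<alpha> *\<^sub>R msmd_direction G C (\<gamma> k) (nat \<lceil>r * real (S k)\<rceil>) (S k)
        (msmd G C r S (\<lambda>j s. \<gamma> j) (\<lambda>j. \<alpha>) x\<^sub>0 y k) (y k)"
  by (simp add: Let_def msmd_direction_def)

text \<open>Telescoping with 1 / b \<le> 2 (b - a) for consecutive square roots a, b, where b^2 -
  a^2 = 1. This handles the growing number of inner steps.\<close>

lemma sum_inverse_sqrt_le:
  "(\<Sum>k<K. 1 / sqrt (real (k + 1))) \<le> 2 * sqrt (real K)"
proof (induction K)
  case (Suc K)
  define a b where "a = sqrt (real K)" and "b = sqrt (real (Suc K))"
  have ab: "0 \<le> a" "0 < b" "b\<^sup>2 = a\<^sup>2 + 1"
    by (auto simp: a_def b_def)
  have "2 * a * b \<le> a\<^sup>2 + b\<^sup>2"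
    using zero_le_power2[of "a - b"] by (simp add: power2_diff)
  also have "\<dots> = 2 * b * b - 1"
    using ab(3) by (simp add: power2_eq_square)
  finally have "(2 * a + 1 / b) * b \<le> (2 * b) * b"
    using ab(2) by (simp add: algebra_simps)
  then have "2 * a + 1 / b \<le> 2 * b"
    using ab(2) by (rule mult_right_le_imp_le)
  with Suc show ?case
    by (simp add: a_def b_def)
qed simp

context msmd_method
begin

definition step_size :: "(nat \<Rightarrow> nat) \<Rightarrow> nat \<Rightarrow> real" where
  "step_size S k = \<theta> / (M_star CARD('m) C \<delta> * sqrt (real (S k)))"

definition iterate :: "(nat \<Rightarrow> nat) \<Rightarrow> nat \<Rightarrow> (nat \<Rightarrow> nat \<Rightarrow> 'x) \<Rightarrow> real^'n" where
  "iterate S k y = msmd G C r S (\<lambda>j s. step_size S j) (\<lambda>j. \<alpha>) x\<^sub>0 y k"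

lemma msmd_run_eq_iterate:
  "msmd_run G C \<delta> r \<theta> \<alpha> x\<^sub>0 \<xi> S k \<omega> = iterate S k (\<lambda>j s. \<xi> j s \<omega>)"
  by (simp add: msmd_run_def iterate_def step_size_def)

lemma step_size_pos: "1 \<le> S k \<Longrightarrow> 0 < step_size S k"
  unfolding step_size_def using \<theta>_pos M_star_pos by simp

definition direction :: "(nat \<Rightarrow> nat) \<Rightarrow> nat \<Rightarrow> real^'n \<Rightarrow> (nat \<Rightarrow> 'x) \<Rightarrow> real^'n" where
  "direction S k = msmd_direction G C (step_size S k) (nat \<lceil>r * real (S k)\<rceil>) (S k)"

lemma iterate_0: "iterate S 0 y = x\<^sub>0"
  by (simp add: iterate_def)

lemma iterate_Suc: "iterate S (Suc k) y = iterate S k y + \<alpha> *\<^sub>R direction S k (iterate S k y) (y k)"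
  unfolding iterate_def direction_def msmd_Suc_direction ..

lemma iterate_cong: "(\<And>j. j < k \<Longrightarrow> y j = y' j) \<Longrightarrow> iterate S k y = iterate S k y'"
  unfolding iterate_def by (rule msmd_cong)

context
  fixes S :: "nat \<Rightarrow> nat"
  assumes S_pos: "\<And>k. 1 \<le> S k"
begin

lemma norm_direction_le: "norm (direction S k x y) \<le> C"
  unfolding direction_def
  by (rule norm_msmd_direction_le[OF card_ge_2 C_pos step_size_pos ceiling_bounds(1)]; rule S_pos)

lemma direction_measurable:
  assumes "X \<in> borel_measurable N" "\<And>s. (\<lambda>\<omega>. Y \<omega> s) \<in> measurable N Q"
  shows "(\<lambda>\<omega>. direction S k (X \<omega>) (Y \<omega>)) \<in> borel_measurable N"
  unfolding direction_def
  by (rule msmd_direction_measurable[OF card_ge_2 C_pos step_size_pos[of S k, OF S_pos] ceiling_bounds(1)[OF S_pos]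
        G_measurable assms])

lemma iterate_measurable:
  assumes "\<And>j s. j < k \<Longrightarrow> (\<lambda>\<omega>. y \<omega> j s) \<in> measurable N Q"
  shows "(\<lambda>\<omega>. iterate S k (y \<omega>)) \<in> borel_measurable N"
  using assms
proof (induction k)
  case (Suc k)
  then have [measurable]: "(\<lambda>\<omega>. iterate S k (y \<omega>)) \<in> borel_measurable N"
    by simp
  have [measurable]: "(\<lambda>\<omega>. direction S k (iterate S k (y \<omega>)) (y \<omega> k)) \<in> borel_measurable N"
    using Suc.prems by (intro direction_measurable) simp_all
  show ?case
    unfolding iterate_Suc by simp
qed (simp add: iterate_0)

lemma norm_iterate_le: "norm (iterate S k y - x\<^sub>0) \<le> real k * (\<alpha> * C)"
proof (induction k)
  case (Suc k)
  have "norm (\<alpha> *\<^sub>R direction S k (iterate S k y) (y k)) \<le> \<alpha> * C"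
    using \<alpha>_pos norm_direction_le by simp
  then have "norm ((iterate S k y - x\<^sub>0) + \<alpha> *\<^sub>R direction S k (iterate S k y) (y k)) \<le> real k * (\<alpha> * C) + \<alpha> * C"
    using Suc by (intro norm_triangle_mono)
  then show ?case
    by (simp add: iterate_Suc algebra_simps)
qed (simp add: iterate_0)

abbreviation X :: "nat \<Rightarrow> 'w \<Rightarrow> real^'n" where
  "X k \<omega> \<equiv> iterate S k (\<lambda>j s. \<xi> j s \<omega>)"

lemma X_measurable[measurable]: "X k \<in> borel_measurable M"
  by (rule iterate_measurable) simp

lemma f_X_integrable: "integrable M (\<lambda>\<omega>. f i (X k \<omega>))"
proof -
  obtain B where "\<And>y. norm (y - x\<^sub>0) \<le> real k * (\<alpha> * C) \<Longrightarrow> \<bar>f i y\<bar> \<le> B"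
    using f_bounded_near[of x\<^sub>0 "real k * (\<alpha> * C)" i] by blast
  moreover have "(\<lambda>\<omega>. f i (X k \<omega>)) \<in> borel_measurable M"
    by (rule measurable_compose[OF X_measurable f_measurable])
  ultimately show ?thesis
    using norm_iterate_le by (intro integrable_const_bound[where B=B]) auto
qed

text \<open>\<open>X k\<close> depends on the sample rows before k and the new direction on row k,
  which are disjoint blocks. Freezing the former makes the fixed-point estimate
  \<open>expected_descent\<close> applicable under the outer integral.\<close>

lemma f_X_freeze:
  fixes i k
  defines "J \<equiv> \<lambda>\<omega>'. \<integral>\<omega>. f i (X k \<omega>' + \<alpha> *\<^sub>R direction S k (X k \<omega>') (\<lambda>s. \<xi> k s \<omega>)) \<partial>M"
  shows "integrable M J" "(\<integral>\<omega>'. J \<omega>' \<partial>M) = (\<integral>\<omega>. f i (X (Suc k) \<omega>) \<partial>M)"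
proof -
  define A :: "(nat \<times> nat) set" where "A = {..<k} \<times> UNIV"
  define B :: "(nat \<times> nat) set" where "B = {k} \<times> UNIV"
  define u where "u = (\<lambda>(x, y). f i (x + \<alpha> *\<^sub>R direction S k x y))"
  have F: "(\<lambda>y. iterate S k (\<lambda>j s. y (j, s))) \<in> borel_measurable (PiM A (\<lambda>_. Q))"
    by (rule iterate_measurable) (simp add: A_def)
  have H: "(\<lambda>y s. y (k, s)) \<in> measurable (PiM B (\<lambda>_. Q)) (PiM UNIV (\<lambda>_. Q))"
    by (rule measurable_PiM_single') (auto simp: B_def space_PiM PiE_iff)
  have X: "X k \<omega> = iterate S k (\<lambda>j s. (restrict (\<lambda>i. (case i of (j, s) \<Rightarrow> \<xi> j s) \<omega>) A) (j, s))" for \<omega>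
    by (rule iterate_cong) (simp add: A_def)
  have Y: "(\<lambda>s. \<xi> k s \<omega>) = (\<lambda>s. (restrict (\<lambda>i. (case i of (j, s) \<Rightarrow> \<xi> j s) \<omega>) B) (k, s))" for \<omega>
    by (simp add: B_def)
  have [measurable]: "(\<lambda>v. direction S k (fst v) (snd v)) \<in> borel_measurable (borel \<Otimes>\<^sub>M PiM UNIV (\<lambda>_. Q))"
    by (rule direction_measurable) simp_all
  have u: "u \<in> borel_measurable (borel \<Otimes>\<^sub>M PiM UNIV (\<lambda>_. Q))"
    unfolding u_def case_prod_unfold by (rule measurable_compose[OF _ f_measurable]) simp
  have Suc: "u (X k \<omega>, \<lambda>s. \<xi> k s \<omega>) = f i (X (Suc k) \<omega>)" for \<omega>
    by (simp add: u_def iterate_Suc)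
  have J: "J = (\<lambda>\<omega>'. \<integral>\<omega>. u (X k \<omega>', \<lambda>s. \<xi> k s \<omega>) \<partial>M)"
    by (simp add: J_def u_def)
  have int: "integrable M (\<lambda>\<omega>. u (X k \<omega>, \<lambda>s. \<xi> k s \<omega>))"
    unfolding Suc by (rule f_X_integrable)
  have AB: "A \<inter> B = {}" "A \<subseteq> UNIV" "B \<subseteq> UNIV"
    by (auto simp: A_def B_def)
  show "integrable M J"
    unfolding J by (rule indep_vars_freeze(1)[OF indep AB F H X Y u int])
  show "(\<integral>\<omega>'. J \<omega>' \<partial>M) = (\<integral>\<omega>. f i (X (Suc k) \<omega>) \<partial>M)"
    using indep_vars_freeze(2)[OF indep AB F H X Y u int] unfolding J Suc .
qed

end

lemma expected_decrease:
  assumes S: "S = (\<lambda>k. (n k)\<^sup>2)" and n: "\<And>k. 1 \<le> n k"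
    and at_X: "AE \<omega> in M. oracle_at Q f G C \<delta> (iterate S k (\<lambda>j s. \<xi> j s \<omega>))"
  shows "\<alpha> / 2 * (\<integral>\<omega>. (norm (common_descent f (iterate S k (\<lambda>j s. \<xi> j s \<omega>))))\<^sup>2 \<partial>M)
    \<le> (\<integral>\<omega>. f i (iterate S k (\<lambda>j s. \<xi> j s \<omega>)) \<partial>M) - (\<integral>\<omega>. f i (iterate S (Suc k) (\<lambda>j s. \<xi> j s \<omega>)) \<partial>M)
      + 2 * \<alpha> * C * (sqrt rate_const / sqrt (real (n k)))"
proof -
  have S_pos: "1 \<le> S k" for k
    using n by (simp add: S)
  define X where "X k \<omega> = iterate S k (\<lambda>j s. \<xi> j s \<omega>)" for k \<omega>
  \<comment> \<open>The square of t is exactly the inner error bound for S k = (n k)^2.\<close>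
  define t where "t = sqrt rate_const / sqrt (real (n k))"
  have t: "0 < t" "t\<^sup>2 = rate_const / real (n k)"
    using rate_const_pos n[of k] by (auto simp: t_def power_divide)
  define D where "D \<omega> = (norm (common_descent f (X k \<omega>)))\<^sup>2" for \<omega>
  define J where "J \<omega>' = (\<integral>\<omega>. f i (X k \<omega>' + \<alpha> *\<^sub>R direction S k (X k \<omega>') (\<lambda>s. \<xi> k s \<omega>)) \<partial>M)" for \<omega>'
  have J: "integrable M J" "(\<integral>\<omega>'. J \<omega>' \<partial>M) = (\<integral>\<omega>. f i (X (Suc k) \<omega>) \<partial>M)"
    using f_X_freeze[where S=S and i=i and k=k, OF S_pos] unfolding J_def[abs_def] X_def by auto
  have fX: "integrable M (\<lambda>\<omega>. f i (X k \<omega>))"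
    unfolding X_def by (rule f_X_integrable[OF S_pos])
  have bound: "(1 + real (S k + 1) * (step_size S k)\<^sup>2 * (C\<^sup>2 * (real CARD('m) * C\<^sup>2 + C\<^sup>2)
      + 8 * ln (real CARD('m)) * (C\<^sup>2 * (real CARD('m) * C\<^sup>2))))
      / (step_size S k * real (S k - nat \<lceil>r * real (S k)\<rceil> + 1)) \<le> t\<^sup>2"
    unfolding t(2) rate_const_def Let_def
    using card_ge_2 by (intro inner_error_bound[OF n]) (auto simp: S step_size_def)
  \<comment> \<open>The oracle condition holds almost surely, so the fixed-point estimate is applied
    at x = X k \<omega> for almost every \<omega>, with J averaging over fresh samples only.\<close>
  have dec: "AE \<omega> in M. \<alpha> / 2 * D \<omega> \<le> f i (X k \<omega>) - J \<omega> + 2 * \<alpha> * C * t"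
    using at_X
  proof eventually_elim
    case (elim \<omega>)
    then show ?case
      using expected_descent[OF _ step_size_pos ceiling_bounds(1) t(1) bound, of "X k \<omega>" i k] S_pos
      by (simp add: X_def D_def J_def direction_def)
  qed
  define R where "R \<omega> = f i (X k \<omega>) - J \<omega> + 2 * \<alpha> * C * t" for \<omega>
  have R: "integrable M R" "(\<integral>\<omega>. R \<omega> \<partial>M) = (\<integral>\<omega>. f i (X k \<omega>) \<partial>M) - (\<integral>\<omega>. f i (X (Suc k) \<omega>) \<partial>M) + 2 * \<alpha> * C * t"
    using fX J by (auto simp: R_def[abs_def] prob_space)
  \<comment> \<open>\<open>D\<close> is not known to be measurable; if it is not integrable, its integral is 0 by convention
    and the bound follows from \<open>R \<ge> 0\<close>.\<close>
  have dec_R: "AE \<omega> in M. \<alpha> / 2 * D \<omega> \<le> R \<omega>"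
    using dec by (simp only: R_def)
  have D_nonneg: "0 \<le> \<alpha> / 2 * D \<omega>" for \<omega>
    using \<alpha>_pos by (simp add: D_def)
  have "AE \<omega> in M. 0 \<le> R \<omega>"
    using dec_R by (rule eventually_mono) (rule order_trans[OF D_nonneg])
  then have "(\<integral>\<omega>. \<alpha> / 2 * D \<omega> \<partial>M) \<le> (\<integral>\<omega>. R \<omega> \<partial>M)"
    by (rule integral_mono_AE'[OF R(1) dec_R])
  then show ?thesis
    unfolding R(2) by (simp add: X_def D_def t_def)
qed

text \<open>Both rules for S enter only through the sum of 1 / sqrt (n k). Descent holds for each
  objective separately, so one index i suffices, and the factor of 1 / sqrt K is free of K, as a
  uniform rate constant requires.\<close>

lemma mean_sq_direction_le:
  assumes S: "S = (\<lambda>k. (n k)\<^sup>2)" and n: "\<And>k. 1 \<le> n k" and K: "1 \<le> K"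
    and along: "assumptions_along M Q f G C \<delta> F_inf (msmd_run G C \<delta> r \<theta> \<alpha> x\<^sub>0 \<xi> S) K"
    and sum: "(\<Sum>k<K. 1 / sqrt (real (n k))) \<le> 2 * sqrt (real K)"
  shows "mean_sq_direction M f (msmd_run G C \<delta> r \<theta> \<alpha> x\<^sub>0 \<xi> S) K
    \<le> (2 / \<alpha> * \<bar>f i x\<^sub>0 - F_inf\<bar> + 8 * C * sqrt rate_const) / sqrt (real K)"
proof -
  define v where "v k = (\<integral>\<omega>. f i (iterate S k (\<lambda>j s. \<xi> j s \<omega>)) \<partial>M)" for k
  define q where "q k = (\<integral>\<omega>. (norm (common_descent f (iterate S k (\<lambda>j s. \<xi> j s \<omega>))))\<^sup>2 \<partial>M)" for k
  have dec: "\<alpha> / 2 * q k \<le> v k - v (Suc k) + 2 * \<alpha> * C * (sqrt rate_const / sqrt (real (n k)))" if "k < K" for k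
    unfolding q_def v_def using along that
    by (intro expected_decrease[OF S n]) (simp add: assumptions_along_def msmd_run_eq_iterate)
  have vK: "F_inf \<le> v K"
    using along by (simp add: assumptions_along_def msmd_run_eq_iterate v_def)
  have v0: "v 0 = f i x\<^sub>0"
    by (simp add: v_def iterate_0 prob_space)
  have K': "1 \<le> sqrt (real K)" "real K = sqrt (real K) * sqrt (real K)"
    using K by auto
  have "\<alpha> / 2 * (\<Sum>k<K. q k) \<le> (\<Sum>k<K. v k - v (Suc k) + 2 * \<alpha> * C * (sqrt rate_const / sqrt (real (n k))))"
    unfolding sum_distrib_left using dec by (intro sum_mono) auto
  also have "\<dots> = v 0 - v K + 2 * \<alpha> * C * sqrt rate_const * (\<Sum>k<K. 1 / sqrt (real (n k)))"
    by (simp add: sum.distrib sum_lessThan_telescope' sum_distrib_left)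
  \<comment> \<open>The initial gap is of order 1; weakening it by sqrt K \<ge> 1 lets it share a
    common factor with the accumulated error.\<close>
  also have "\<dots> \<le> \<bar>f i x\<^sub>0 - F_inf\<bar> * sqrt (real K) + 2 * \<alpha> * C * sqrt rate_const * (2 * sqrt (real K))"
  proof (intro add_mono mult_left_mono sum)
    have "v 0 - v K \<le> \<bar>f i x\<^sub>0 - F_inf\<bar> * 1"
      using vK v0 by simp
    also have "\<dots> \<le> \<bar>f i x\<^sub>0 - F_inf\<bar> * sqrt (real K)"
      using K' by (intro mult_left_mono) auto
    finally show "v 0 - v K \<le> \<bar>f i x\<^sub>0 - F_inf\<bar> * sqrt (real K)" .
  qed (use \<alpha>_pos C_pos rate_const_pos in auto)
  also have "\<dots> = \<alpha> / 2 * ((2 / \<alpha> * \<bar>f i x\<^sub>0 - F_inf\<bar> + 8 * C * sqrt rate_const) * sqrt (real K))"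
    using \<alpha>_pos by (simp add: field_simps)
  finally have "(\<Sum>k<K. q k) \<le> (2 / \<alpha> * \<bar>f i x\<^sub>0 - F_inf\<bar> + 8 * C * sqrt rate_const) * sqrt (real K)"
    using \<alpha>_pos by (subst (asm) mult_le_cancel_left_pos) auto
  then have "1 / real K * (\<Sum>k<K. q k)
      \<le> 1 / real K * ((2 / \<alpha> * \<bar>f i x\<^sub>0 - F_inf\<bar> + 8 * C * sqrt rate_const) * sqrt (real K))"
    by (intro mult_left_mono) auto
  also have "\<dots> = (2 / \<alpha> * \<bar>f i x\<^sub>0 - F_inf\<bar> + 8 * C * sqrt rate_const) / sqrt (real K)"
    using sqrt_divide_self_eq[of "real K"] by (simp add: divide_inverse mult.commute mult.left_commute)
  finally show ?thesis
    by (simp add: mean_sq_direction_def q_def msmd_run_eq_iterate)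
qed

text \<open>The ceiling is at most S, so the denominator of the diameter term is positive and that
  term is nonnegative. What remains is a bound uniform in S.\<close>

lemma M_one_ge:
  assumes "1 \<le> S"
  shows "2 * max \<theta> (1 / \<theta>) * M_star CARD('m) C \<delta> \<le> M_one CARD('m) C \<delta> r \<theta> D S"
proof -
  have "r * real S \<le> 1 * real S"
    using r_less by (intro mult_right_mono) auto
  then have "\<lceil>r * real S\<rceil> \<le> int S"
    by (intro ceiling_le) simp
  then have "0 \<le> 2 * D\<^sup>2 * real S / (real S - real_of_int \<lceil>r * real S\<rceil> + 1)"
    by (intro divide_nonneg_nonneg) auto
  then show ?thesis
    unfolding M_one_def using M_star_pos \<theta>_pos by (intro mult_right_mono) auto
qed

lemma msmd_rate:
  "(\<exists>c>0. \<forall>K\<ge>1.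
      let X = msmd_run G C \<delta> r \<theta> \<alpha> x\<^sub>0 \<xi> (\<lambda>_. (K + 1)\<^sup>2);
          M1 = M_one CARD('m) C \<delta> r \<theta> D ((K + 1)\<^sup>2)
      in assumptions_along M Q f G C \<delta> F_inf X K \<longrightarrow>
         mean_sq_direction M f X K \<le> c * (4 * C * sqrt M1 * (1 / sqrt (real K))))
   \<and> (\<exists>c>0. \<forall>K\<ge>4.
      let X = msmd_run G C \<delta> r \<theta> \<alpha> x\<^sub>0 \<xi> (\<lambda>k. (k + 1)\<^sup>2);
          M1 = (MAX k\<in>{..<K}. M_one CARD('m) C \<delta> r \<theta> D ((k + 1)\<^sup>2))
      in assumptions_along M Q f G C \<delta> F_inf X K \<longrightarrow>
         mean_sq_direction M f X K
           \<le> c * (max (8 * C * sqrt M1) (4 * L * \<alpha> * M1) * (1 / sqrt (real K))))"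
proof -
  \<comment> \<open>Any objective serves; \<open>undefined\<close> only names an element of the
    index type.\<close>
  define i :: 'm where "i = undefined"
  define H where "H = 2 / \<alpha> * \<bar>f i x\<^sub>0 - F_inf\<bar> + 8 * C * sqrt rate_const"
  define \<mu> where "\<mu> = 2 * max \<theta> (1 / \<theta>) * M_star CARD('m) C \<delta>"
  \<comment> \<open>Solves H = c * (4 C sqrt \<mu>) for the lower bound \<mu> of M1. The same c
    serves both claims, because the maximum in the second is at least 8 C sqrt M1.\<close>
  define c where "c = H / (4 * C * sqrt \<mu>)"
  have H: "0 < H"
    unfolding H_def using \<alpha>_pos C_pos rate_const_pos by (intro add_nonneg_pos) auto
  have \<mu>: "0 < \<mu>"
    unfolding \<mu>_def using \<theta>_pos M_star_pos by (auto simp: max_def)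
  have c: "0 < c" "H = c * (4 * C * sqrt \<mu>)"
    using H \<mu> C_pos by (auto simp: c_def)
  have scale: "a \<le> c * (b * (1 / sqrt (real K)))"
    if "a \<le> H / sqrt (real K)" "4 * C * sqrt \<mu> \<le> b" for a b K
  proof -
    have "H / sqrt (real K) \<le> (c * b) / sqrt (real K)"
      unfolding c(2) using that(2) c(1) by (intro divide_right_mono mult_left_mono) auto
    with that(1) show ?thesis by simp
  qed
  have a: "mean_sq_direction M f (msmd_run G C \<delta> r \<theta> \<alpha> x\<^sub>0 \<xi> (\<lambda>_. (K + 1)\<^sup>2)) K
      \<le> c * (4 * C * sqrt (M_one CARD('m) C \<delta> r \<theta> D ((K + 1)\<^sup>2)) * (1 / sqrt (real K)))"
    if K: "1 \<le> K" and along: "assumptions_along M Q f G C \<delta> F_inf (msmd_run G C \<delta> r \<theta> \<alpha> x\<^sub>0 \<xi> (\<lambda>_. (K + 1)\<^sup>2)) K" for K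
  proof (rule scale)
    \<comment> \<open>All terms coincide here, so the sum is at most sqrt K; the factor 2 of the
      common estimate is slack.\<close>
    have "(\<Sum>k<K. 1 / sqrt (real (K + 1))) \<le> (\<Sum>k<K. 1 / sqrt (real K))"
      using K by (intro sum_mono divide_left_mono) auto
    also have "\<dots> = sqrt (real K)"
      by (simp add: real_div_sqrt)
    finally have "(\<Sum>k<K. 1 / sqrt (real (K + 1))) \<le> 2 * sqrt (real K)"
      using real_sqrt_ge_zero[of "real K"] by linarith
    then show "mean_sq_direction M f (msmd_run G C \<delta> r \<theta> \<alpha> x\<^sub>0 \<xi> (\<lambda>_. (K + 1)\<^sup>2)) K \<le> H / sqrt (real K)"
      unfolding H_def by (intro mean_sq_direction_le[where n="\<lambda>_. K + 1"] along K) auto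
    show "4 * C * sqrt \<mu> \<le> 4 * C * sqrt (M_one CARD('m) C \<delta> r \<theta> D ((K + 1)\<^sup>2))"
      unfolding \<mu>_def using C_pos by (intro mult_left_mono real_sqrt_le_mono M_one_ge) auto
  qed
  have b: "mean_sq_direction M f (msmd_run G C \<delta> r \<theta> \<alpha> x\<^sub>0 \<xi> (\<lambda>k. (k + 1)\<^sup>2)) K
      \<le> c * (max (8 * C * sqrt M1) (4 * L * \<alpha> * M1) * (1 / sqrt (real K)))"
    if K: "4 \<le> K" and along: "assumptions_along M Q f G C \<delta> F_inf (msmd_run G C \<delta> r \<theta> \<alpha> x\<^sub>0 \<xi> (\<lambda>k. (k + 1)\<^sup>2)) K"
      and M1: "M1 = (MAX k\<in>{..<K}. M_one CARD('m) C \<delta> r \<theta> D ((k + 1)\<^sup>2))" for K M1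
  proof (rule scale)
    show "mean_sq_direction M f (msmd_run G C \<delta> r \<theta> \<alpha> x\<^sub>0 \<xi> (\<lambda>k. (k + 1)\<^sup>2)) K \<le> H / sqrt (real K)"
      unfolding H_def using K sum_inverse_sqrt_le
      by (intro mean_sq_direction_le[where n="\<lambda>k. k + 1"] along) auto
    \<comment> \<open>The entry k = 0, where S = 1, already bounds the maximum from below.\<close>
    have "\<mu> \<le> M_one CARD('m) C \<delta> r \<theta> D ((0 + 1)\<^sup>2)"
      unfolding \<mu>_def by (rule M_one_ge) simp
    also have "\<dots> \<le> M1"
      unfolding M1 using K by (intro Max_ge image_eqI[of _ _ 0]) auto
    finally have "4 * C * sqrt \<mu> \<le> 8 * C * sqrt M1"
      using C_pos \<mu> by (intro mult_mono) auto
    then show "4 * C * sqrt \<mu> \<le> max (8 * C * sqrt M1) (4 * L * \<alpha> * M1)"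
      by simp
  qed
  show ?thesis
    unfolding Let_def using a b c(1) by blast
qed

end

theorem corollary4p1:
  fixes f :: "'m::finite \<Rightarrow> real^'n \<Rightarrow> real"
    and G :: "'m \<Rightarrow> real^'n \<Rightarrow> 'x \<Rightarrow> real^'n"
    and Q :: "'x measure"
    and M :: "'w measure"
    and \<xi> :: "nat \<Rightarrow> nat \<Rightarrow> 'w \<Rightarrow> 'x"
    and x\<^sub>0 :: "real^'n"
    and L F_inf C\<^sub>f \<delta> \<theta> \<alpha> r D :: real
  assumes "CARD('m) \<ge> 2"
    and "\<And>i x. f i differentiable (at x)"
    and "\<And>i. L-lipschitz_on UNIV (grad (f i))"
    and "prob_space M"
    and "\<And>i. (\<lambda>(x, y). G i x y) \<in> borel_measurable (borel \<Otimes>\<^sub>M Q)"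
    and "prob_space.indep_vars M (\<lambda>_. Q) (\<lambda>(k, s). \<xi> k s) UNIV"
    and "\<And>k s. distr M Q (\<xi> k s) = Q"
    and "0 < L" and "0 < C\<^sub>f" and "0 \<le> \<delta>" and "0 < \<theta>"
    and "0 < r" and "r < 1"
    and "0 < \<alpha>" and "\<alpha> \<le> 1 / (4 * L)"
    and "0 \<le> D"
    and "ereal D \<le> bregman_diam (omega_z C\<^sub>f) (Z_set C\<^sub>f :: ((real^'n) \<times> (real^'m)) set)"
  shows "(\<exists>c>0. \<forall>K\<ge>1.
            let X = msmd_run G C\<^sub>f \<delta> r \<theta> \<alpha> x\<^sub>0 \<xi> (\<lambda>_. (K + 1)\<^sup>2);
                M1 = M_one CARD('m) C\<^sub>f \<delta> r \<theta> D ((K + 1)\<^sup>2)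
            in assumptions_along M Q f G C\<^sub>f \<delta> F_inf X K \<longrightarrow>
               mean_sq_direction M f X K \<le> c * (4 * C\<^sub>f * sqrt M1 * (1 / sqrt (real K))))
       \<and> (\<exists>c>0. \<forall>K\<ge>4.
            let X = msmd_run G C\<^sub>f \<delta> r \<theta> \<alpha> x\<^sub>0 \<xi> (\<lambda>k. (k + 1)\<^sup>2);
                M1 = (MAX k\<in>{..<K}. M_one CARD('m) C\<^sub>f \<delta> r \<theta> D ((k + 1)\<^sup>2))
            in assumptions_along M Q f G C\<^sub>f \<delta> F_inf X K \<longrightarrow>
               mean_sq_direction M f X K
                 \<le> c * (max (8 * C\<^sub>f * sqrt M1) (4 * L * \<alpha> * M1) * (1 / sqrt (real K))))"
proof -
  interpret prob_space M
    by fact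
  interpret msmd_method M f G Q \<xi> x\<^sub>0 L F_inf C\<^sub>f \<delta> \<theta> \<alpha> r
    by unfold_locales (use assms in auto)
  show ?thesis
    by (rule msmd_rate)
qed

end
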